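(* For every $k\ge 0$, the indecomposable permutations (of any length) that avoid $132$ and $2341$ and have exactly $k$ inversions are in bijection with $\mathrm{SPM}(k)$, and thus $$C_{1324,2341}(x)=\left(1+\sum_{k\ge 1}x^{\frac{k(k+1)}{2}}\cdot\prod_{i=1}^k\left(x+\frac{1}{1-x^i}\right)\right)^2.$$
   Context: The direct sum of $\sigma\in S_n$ and $\tau\in S_m$ is $\sigma\oplus\tau\in S_{n+m}$ with $(\sigma\oplus\tau)(i)=\sigma(i)$ for $i\le n$ and $(\sigma\oplus\tau)(i)=n+\tau(i-n)$ for $i>n$. A nonempty permutation is indecomposable if it is not the direct sum of two nonempty permutations. A permutation avoids a pattern $q$ if it has no subsequence order-isomorphic to $q$; inversions of $\pi$ are pairs $i<j$ with $\pi_i>\pi_j$. $\mathrm{SPM}(k)$ (the sand pile model) is the set of partitions of $k$ defined recursively: the one-part partition $(k)$ is in $\mathrm{SPM}(k)$, and if $\lambda\in\mathrm{SPM}(k)$ then every partition (weakly decreasing sequence) that can be obtained from $\lambda$ by subtracting one from a part and adding one to the next part (which may be a zero part at the end) is also in $\mathrm{SPM}(k)$. $\mathrm{SPM}(0)$ consists of the empty partition. $\mathrm{av}_n^k(B)$ is the number of permutations in $S_n$ with exactly $k$ inversions that avoid every pattern in $B$. If for every $k\ge0$ there are constants $m_k,c_k(B)$ with $\mathrm{av}_n^k(B)=c_k(B)$ for all $n\ge m_k$, then $(c_k(B))_{k\ge0}$ is the limit sequence of $B$ and $C_B(x)=\sum_{k\ge 0}c_k(B)x^k$ is its limit generating function.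 *)

theory Defs
  imports
    "HOL-Library.Sublist"
    "HOL-Combinatorics.Multiset_Permutations"
    "HOL-Computational_Algebra.Formal_Power_Series"
begin

text \<open>
  Permutations are in one-line notation: the elements of $S_n$ are the lists in
  \<^term>\<open>permutations_of_set {1..n}\<close>. List positions count from \<open>0\<close>, values from \<open>1\<close>.
\<close>

definition is_perm :: "nat list \<Rightarrow> bool" where
  "is_perm \<pi> \<longleftrightarrow> \<pi> \<in> permutations_of_set {1..length \<pi>}"

definition direct_sum :: "nat list \<Rightarrow> nat list \<Rightarrow> nat list" where
  "direct_sum \<sigma> \<tau> = \<sigma> @ map (\<lambda>v. length \<sigma> + v) \<tau>"

definition indecomposable :: "nat list \<Rightarrow> bool" where
  "indecomposable \<pi> \<longleftrightarrow> is_perm \<pi> \<and> \<pi> \<noteq> [] \<and>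
     \<not> (\<exists>\<sigma> \<tau>. is_perm \<sigma> \<and> is_perm \<tau> \<and> \<sigma> \<noteq> [] \<and> \<tau> \<noteq> [] \<and> \<pi> = direct_sum \<sigma> \<tau>)"

definition order_iso :: "nat list \<Rightarrow> nat list \<Rightarrow> bool" where
  "order_iso s q \<longleftrightarrow> length s = length q \<and>
     (\<forall>i < length q. \<forall>j < length q. s ! i < s ! j \<longleftrightarrow> q ! i < q ! j)"

definition avoids :: "nat list \<Rightarrow> nat list \<Rightarrow> bool" where
  "avoids \<pi> q \<longleftrightarrow> \<not> (\<exists>s. subseq s \<pi> \<and> order_iso s q)"

definition inversions :: "nat list \<Rightarrow> (nat \<times> nat) set" where
  "inversions \<pi> = {(i, j). i < j \<and> j < length \<pi> \<and> \<pi> ! i > \<pi> ! j}"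

definition av :: "nat list set \<Rightarrow> nat \<Rightarrow> nat \<Rightarrow> nat" where
  "av B n k = card {\<pi> \<in> permutations_of_set {1..n}.
     card (inversions \<pi>) = k \<and> (\<forall>q \<in> B. avoids \<pi> q)}"

definition is_limit_sequence :: "nat list set \<Rightarrow> (nat \<Rightarrow> nat) \<Rightarrow> bool" where
  "is_limit_sequence B c \<longleftrightarrow> (\<forall>k. \<exists>m. \<forall>n \<ge> m. av B n k = c k)"

text \<open>Only meaningful when a limit sequence exists; it is then unique.\<close>

definition limit_sequence :: "nat list set \<Rightarrow> nat \<Rightarrow> nat" where
  "limit_sequence B = (THE c. is_limit_sequence B c)"

definition limit_gf :: "nat list set \<Rightarrow> rat fps" where
  "limit_gf B = Abs_fps (\<lambda>k. of_nat (limit_sequence B k))"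

lemma limit_sequence_eq:
  assumes "is_limit_sequence B c"
  shows "limit_sequence B = c"
  unfolding limit_sequence_def
proof (rule the_equality)
  fix d assume d: "is_limit_sequence B d"
  show "d = c"
  proof
    fix k
    obtain m m' where "\<forall>n\<ge>m. av B n k = c k" "\<forall>n\<ge>m'. av B n k = d k"
      using assms d unfolding is_limit_sequence_def by blast
    then show "d k = c k"
      by (metis max.cobounded1 max.cobounded2)
  qed
qed (fact assms)

definition is_partition :: "nat list \<Rightarrow> bool" where
  "is_partition xs \<longleftrightarrow> sorted_wrt (\<ge>) xs \<and> (\<forall>x \<in> set xs. x > 0)"

text \<open>
  The rule \<open>new_part\<close> is the move in which the next part is the zero part at the end.
\<close>

inductive_set SPM :: "nat \<Rightarrow> nat list set" for k :: nat where
  empty: "k = 0 \<Longrightarrow> [] \<in> SPM k"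
| one_part: "k > 0 \<Longrightarrow> [k] \<in> SPM k"
| move: "xs @ Suc a # b # ys \<in> SPM k \<Longrightarrow> is_partition (xs @ a # Suc b # ys)
    \<Longrightarrow> xs @ a # Suc b # ys \<in> SPM k"
| new_part: "xs @ [Suc a] \<in> SPM k \<Longrightarrow> is_partition (xs @ [a, 1])
    \<Longrightarrow> xs @ [a, 1] \<in> SPM k"

end

theory Submission
  imports Defs
begin

text \<open>
  A permutation avoids 132 iff its Lehmer code \<open>c\<close> (where \<open>c\<^sub>i\<close> counts the later entries smaller
  than \<open>\<pi>\<^sub>i\<close>) is weakly decreasing. For such a permutation, avoiding 2341 means
  \<open>c\<^sub>j + j \<le> c\<^sub>i + i + 1\<close> whenever \<open>i < j\<close> and \<open>c\<^sub>j > 0\<close>, and indecomposability determines the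
  length from the nonzero part of the code. The same inequality characterizes the partitions
  in the sand pile model: every move preserves it, and a move can always be undone.

  For the generating function, let \<open>m\<close> be the minimum of \<open>\<lambda>\<^sub>i + i\<close>, so that
  \<open>(m, m - 1, \<dots>, 1)\<close> is the largest staircase contained in \<open>\<lambda>\<close>. Subtracting it leaves a list of length
  \<open>m + 1\<close> that contains a zero and whose later entries exceed earlier ones by at most 1; removing
  its last entry (0 or 1) or subtracting 1 everywhere gives the factors \<open>x + 1 / (1 - x\<^sup>i)\<close>.

  A long permutation with few inversions that avoids 1324 and 2341 is \<open>\<sigma> \<oplus> id \<oplus> \<tau>\<close> with \<open>\<sigma>\<close>, \<open>\<tau>\<close>
  indecomposable, \<open>\<sigma>\<close> avoiding 132 and \<open>\<tau>\<close> avoiding 213. Reverse-complement-inverse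
  exchanges these two classes, hence the square.
\<close>

subsection \<open>Patterns and direct sums\<close>

text \<open>Matches the first letter at a position \<open>i\<close> and continues in
  \<open>drop (Suc i) ys\<close>, again of the form \<open>drop _ ys\<close>. Iterated unfolding
  therefore turns a subsequence of fixed length into an increasing chain of positions.\<close>

lemma subseq_Cons_drop_iff:
  "subseq (x # xs) (drop p ys) \<longleftrightarrow>
     (\<exists>i\<ge>p. i < length ys \<and> ys ! i = x \<and> subseq xs (drop (Suc i) ys))"
proof
  assume "subseq (x # xs) (drop p ys)"
  then obtain us vs where uv: "drop p ys = us @ x # vs" "subseq xs vs"
    by (auto dest: list_emb_ConsD)
  let ?i = "p + length us"
  have len: "?i < length ys"
    using arg_cong[OF uv(1), of length] by simp
  moreover have "ys ! ?i = x"
    using len arg_cong[OF uv(1), of "\<lambda>l. l ! length us"] by (simp add: nth_append)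
  moreover have "drop (Suc ?i) ys = vs"
    using arg_cong[OF uv(1), of "drop (Suc (length us))"] by (simp add: add.commute)
  ultimately show "\<exists>i\<ge>p. i < length ys \<and> ys ! i = x \<and> subseq xs (drop (Suc i) ys)"
    using uv(2) by (intro exI[of _ ?i]) simp
next
  assume "\<exists>i\<ge>p. i < length ys \<and> ys ! i = x \<and> subseq xs (drop (Suc i) ys)"
  then obtain i where i: "i \<ge> p" "i < length ys" "ys ! i = x" "subseq xs (drop (Suc i) ys)"
    by blast
  have "drop i ys = x # drop (Suc i) ys"
    using i Cons_nth_drop_Suc[of i ys] by simp
  moreover have "drop i ys = drop (i - p) (drop p ys)"
    using i by simp
  ultimately show "subseq (x # xs) (drop p ys)"
    using i(4) by (metis append_take_drop_id subseq_Cons2_iff subseq_drop_many)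
qed

lemma subseq3_iff:
  "subseq [a, b, c] ys \<longleftrightarrow>
     (\<exists>i j k. i < j \<and> j < k \<and> k < length ys \<and> ys ! i = a \<and> ys ! j = b \<and> ys ! k = c)"
  (is "_ \<longleftrightarrow> ?R")
proof -
  have "subseq [a, b, c] (drop 0 ys) \<longleftrightarrow> ?R"
  proof
    assume "subseq [a, b, c] (drop 0 ys)"
    then obtain i j k where "Suc i \<le> j" "Suc j \<le> k" "k < length ys"
      "ys ! i = a" "ys ! j = b" "ys ! k = c"
      unfolding subseq_Cons_drop_iff by blast
    then show ?R
      unfolding Suc_le_eq by blast
  next
    assume ?R
    then obtain i j k where "i < j" "j < k" "k < length ys" "ys ! i = a" "ys ! j = b" "ys ! k = c"
      by blast
    then show "subseq [a, b, c] (drop 0 ys)"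
      unfolding subseq_Cons_drop_iff
      by (intro exI[of _ i] exI[of _ j] exI[of _ k] conjI) simp_all
  qed
  then show ?thesis
    by simp
qed

lemma subseq4_iff:
  "subseq [a, b, c, d] ys \<longleftrightarrow>
     (\<exists>i j k l. i < j \<and> j < k \<and> k < l \<and> l < length ys \<and>
        ys ! i = a \<and> ys ! j = b \<and> ys ! k = c \<and> ys ! l = d)"
  (is "_ \<longleftrightarrow> ?R")
proof -
  have "subseq [a, b, c, d] (drop 0 ys) \<longleftrightarrow> ?R"
  proof
    assume "subseq [a, b, c, d] (drop 0 ys)"
    then obtain i j k l where "Suc i \<le> j" "Suc j \<le> k" "Suc k \<le> l" "l < length ys"
      "ys ! i = a" "ys ! j = b" "ys ! k = c" "ys ! l = d"
      unfolding subseq_Cons_drop_iff by blast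
    then show ?R
      unfolding Suc_le_eq by blast
  next
    assume ?R
    then obtain i j k l where "i < j" "j < k" "k < l" "l < length ys"
      "ys ! i = a" "ys ! j = b" "ys ! k = c" "ys ! l = d"
      by blast
    then show "subseq [a, b, c, d] (drop 0 ys)"
      unfolding subseq_Cons_drop_iff
      by (intro exI[of _ i] exI[of _ j] exI[of _ k] exI[of _ l] conjI) simp_all
  qed
  then show ?thesis
    by simp
qed

lemma order_iso3_iff:
  "order_iso [a, b, c] [p, q, r] \<longleftrightarrow>
     (a < b \<longleftrightarrow> p < q) \<and> (a < c \<longleftrightarrow> p < r) \<and> (b < c \<longleftrightarrow> q < r) \<and>
     (b < a \<longleftrightarrow> q < p) \<and> (c < a \<longleftrightarrow> r < p) \<and> (c < b \<longleftrightarrow> r < q)"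
  unfolding order_iso_def by (simp add: All_less_Suc) blast

lemma order_iso4_iff:
  "order_iso [a, b, c, d] [p, q, r, s] \<longleftrightarrow>
     (a < b \<longleftrightarrow> p < q) \<and> (a < c \<longleftrightarrow> p < r) \<and> (a < d \<longleftrightarrow> p < s) \<and>
     (b < c \<longleftrightarrow> q < r) \<and> (b < d \<longleftrightarrow> q < s) \<and> (c < d \<longleftrightarrow> r < s) \<and>
     (b < a \<longleftrightarrow> q < p) \<and> (c < a \<longleftrightarrow> r < p) \<and> (d < a \<longleftrightarrow> s < p) \<and>
     (c < b \<longleftrightarrow> r < q) \<and> (d < b \<longleftrightarrow> s < q) \<and> (d < c \<longleftrightarrow> s < r)"
  unfolding order_iso_def by (simp add: All_less_Suc) argo

lemma not_avoids3_iff: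
  "\<not> avoids \<pi> [p, q, r] \<longleftrightarrow>
     (\<exists>i j k. i < j \<and> j < k \<and> k < length \<pi> \<and> order_iso [\<pi> ! i, \<pi> ! j, \<pi> ! k] [p, q, r])"
proof -
  have "\<exists>a b c. s = [a, b, c]" if "order_iso s [p, q, r]" for s
  proof -
    have "length s = Suc (Suc (Suc 0))"
      using that by (simp add: order_iso_def)
    then show ?thesis
      by (auto simp only: length_Suc_conv length_0_conv)
  qed
  then have "\<not> avoids \<pi> [p, q, r] \<longleftrightarrow>
      (\<exists>a b c. subseq [a, b, c] \<pi> \<and> order_iso [a, b, c] [p, q, r])"
    unfolding avoids_def by blast
  then show ?thesis
    unfolding subseq3_iff by blast
qed

lemma not_avoids4_iff:
  "\<not> avoids \<pi> [p, q, r, s] \<longleftrightarrow>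
     (\<exists>i j k l. i < j \<and> j < k \<and> k < l \<and> l < length \<pi> \<and>
        order_iso [\<pi> ! i, \<pi> ! j, \<pi> ! k, \<pi> ! l] [p, q, r, s])"
proof -
  have "\<exists>a b c d. t = [a, b, c, d]" if "order_iso t [p, q, r, s]" for t
  proof -
    have "length t = Suc (Suc (Suc (Suc 0)))"
      using that by (simp add: order_iso_def)
    then show ?thesis
      by (auto simp only: length_Suc_conv length_0_conv)
  qed
  then have "\<not> avoids \<pi> [p, q, r, s] \<longleftrightarrow>
      (\<exists>a b c d. subseq [a, b, c, d] \<pi> \<and> order_iso [a, b, c, d] [p, q, r, s])"
    unfolding avoids_def by blast
  then show ?thesis
    unfolding subseq4_iff by blast
qed

lemma avoids_132_iff:
  "avoids \<pi> [1,3,2] \<longleftrightarrow>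
     \<not> (\<exists>i j k. i < j \<and> j < k \<and> k < length \<pi> \<and> \<pi> ! i < \<pi> ! k \<and> \<pi> ! k < \<pi> ! j)"
proof -
  have "order_iso [a, b, c] [1,3,2] \<longleftrightarrow> a < c \<and> c < b" for a b c
    by (auto simp: order_iso3_iff)
  then show ?thesis
    using not_avoids3_iff[of \<pi> 1 3 2] by metis
qed

lemma avoids_213_iff:
  "avoids \<pi> [2,1,3] \<longleftrightarrow>
     \<not> (\<exists>i j k. i < j \<and> j < k \<and> k < length \<pi> \<and> \<pi> ! j < \<pi> ! i \<and> \<pi> ! i < \<pi> ! k)"
proof -
  have "order_iso [a, b, c] [2,1,3] \<longleftrightarrow> b < a \<and> a < c" for a b c
    by (auto simp: order_iso3_iff)
  then show ?thesis
    using not_avoids3_iff[of \<pi> 2 1 3] by metis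
qed

lemma avoids_2341_iff:
  "avoids \<pi> [2,3,4,1] \<longleftrightarrow>
     \<not> (\<exists>i j k l. i < j \<and> j < k \<and> k < l \<and> l < length \<pi> \<and>
          \<pi> ! l < \<pi> ! i \<and> \<pi> ! i < \<pi> ! j \<and> \<pi> ! j < \<pi> ! k)"
proof -
  have "order_iso [a, b, c, d] [2,3,4,1] \<longleftrightarrow> d < a \<and> a < b \<and> b < c" for a b c d
    by (auto simp: order_iso4_iff)
  then show ?thesis
    using not_avoids4_iff[of \<pi> 2 3 4 1] by metis
qed

lemma avoids_1324_iff:
  "avoids \<pi> [1,3,2,4] \<longleftrightarrow>
     \<not> (\<exists>i j k l. i < j \<and> j < k \<and> k < l \<and> l < length \<pi> \<and>
          \<pi> ! i < \<pi> ! k \<and> \<pi> ! k < \<pi> ! j \<and> \<pi> ! j < \<pi> ! l)"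
proof -
  have "order_iso [a, b, c, d] [1,3,2,4] \<longleftrightarrow> a < c \<and> c < b \<and> b < d" for a b c d
    by (auto simp: order_iso4_iff)
  then show ?thesis
    using not_avoids4_iff[of \<pi> 1 3 2 4] by metis
qed

section \<open>Direct sums and cuts of permutations\<close>

lemma is_perm_iff: "is_perm \<pi> \<longleftrightarrow> distinct \<pi> \<and> set \<pi> = {1..length \<pi>}"
  by (auto simp: is_perm_def permutations_of_set_def)

lemma is_perm_nth:
  assumes "is_perm \<pi>" "i < length \<pi>"
  shows "1 \<le> \<pi> ! i" "\<pi> ! i \<le> length \<pi>"
  using assms nth_mem[of i \<pi>] by (auto simp: is_perm_iff)

lemma is_perm_nth_eq_iff:
  assumes "is_perm \<pi>" "i < length \<pi>" "j < length \<pi>"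
  shows "\<pi> ! i = \<pi> ! j \<longleftrightarrow> i = j"
  using assms by (simp add: is_perm_iff nth_eq_iff_index_eq)

lemma direct_sum_nth:
  "i < length \<sigma> + length \<tau> \<Longrightarrow>
     direct_sum \<sigma> \<tau> ! i = (if i < length \<sigma> then \<sigma> ! i else length \<sigma> + \<tau> ! (i - length \<sigma>))"
  by (simp add: direct_sum_def nth_append)

lemma length_direct_sum [simp]: "length (direct_sum \<sigma> \<tau>) = length \<sigma> + length \<tau>"
  by (simp add: direct_sum_def)

lemma is_perm_direct_sum:
  assumes "is_perm \<sigma>" "is_perm \<tau>"
  shows "is_perm (direct_sum \<sigma> \<tau>)"
proof -
  have img: "(\<lambda>v. length \<sigma> + v) ` {1..length \<tau>} = {length \<sigma> + 1..length \<sigma> + length \<tau>}"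
    by (simp add: image_add_atLeastAtMost)
  have "set (direct_sum \<sigma> \<tau>) = {1..length \<sigma>} \<union> {length \<sigma> + 1..length \<sigma> + length \<tau>}"
    using assms img by (simp add: direct_sum_def is_perm_iff add.commute)
  also have "\<dots> = {1..length \<sigma> + length \<tau>}"
    by auto
  finally have "set (direct_sum \<sigma> \<tau>) = {1..length \<sigma> + length \<tau>}" .
  moreover have "distinct (direct_sum \<sigma> \<tau>)"
    using assms by (auto simp: direct_sum_def is_perm_iff distinct_map inj_on_def)
  ultimately show ?thesis
    by (simp add: is_perm_iff)
qed

text \<open>The first \<open>p\<close> entries are distinct and lie in \<open>{1..p}\<close>, so
  they exhaust it; the remaining entries are then exactly the values above \<open>p\<close>, and
  lowering them by \<open>p\<close> gives the second summand.\<close>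

lemma prefix_closed_split:
  assumes "is_perm \<pi>" "p \<le> length \<pi>" "\<And>i. i < p \<Longrightarrow> \<pi> ! i \<le> p"
  obtains \<tau> where "is_perm (take p \<pi>)" "is_perm \<tau>" "length \<tau> = length \<pi> - p"
    "\<pi> = direct_sum (take p \<pi>) \<tau>"
proof
  let ?\<tau> = "map (\<lambda>v. v - p) (drop p \<pi>)"
  have dist: "distinct \<pi>" and set: "set \<pi> = {1..length \<pi>}"
    using assms(1) by (simp_all add: is_perm_iff)
  have sub: "set (take p \<pi>) \<subseteq> {1..p}"
    using assms(2,3) is_perm_nth(1)[OF assms(1)]
    by (auto simp: in_set_conv_nth)
  have st: "set (take p \<pi>) = {1..p}"
    using dist assms(2) by (intro card_subset_eq[OF _ sub]) (simp_all add: distinct_card)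
  have "set (take p \<pi>) \<union> set (drop p \<pi>) = set \<pi>"
    by (metis append_take_drop_id set_append)
  moreover have "set (take p \<pi>) \<inter> set (drop p \<pi>) = {}"
    using dist by (metis append_take_drop_id distinct_append)
  ultimately have "set (drop p \<pi>) = set \<pi> - set (take p \<pi>)"
    by blast
  also have "\<dots> = {1..length \<pi>} - {1..p}"
    by (simp only: st set)
  also have "\<dots> = {p+1..length \<pi>}"
    by auto
  finally have sd: "set (drop p \<pi>) = {p+1..length \<pi>}" .
  show "is_perm (take p \<pi>)"
    using dist assms(2) st by (simp add: is_perm_iff)
  have "(\<lambda>v. v - p) ` {p+1..length \<pi>} = {1..length \<pi> - p}"
    using assms(2) by (auto simp: image_iff intro!: bexI[of _ "_ + p"])
  moreover have "distinct ?\<tau>"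
    using dist sd by (auto simp: distinct_map inj_on_def)
  ultimately show "is_perm ?\<tau>"
    by (simp add: is_perm_iff sd)
  show "length ?\<tau> = length \<pi> - p"
    by simp
  have "map (\<lambda>v. p + v) ?\<tau> = drop p \<pi>"
    using sd by (auto intro!: map_idI simp: comp_def)
  then show "\<pi> = direct_sum (take p \<pi>) ?\<tau>"
    using assms(2) by (simp add: direct_sum_def min_def)
qed

text \<open>Call \<open>p\<close> a cut if the first \<open>p\<close> entries are all at most
  \<open>p\<close>. Decompositions correspond to cuts strictly between 0 and the length, which makes
  indecomposability a condition on single entries.\<close>

lemma indecomposable_iff:
  "indecomposable \<pi> \<longleftrightarrow> is_perm \<pi> \<and> \<pi> \<noteq> [] \<and>
     (\<forall>p. 0 < p \<and> p < length \<pi> \<longrightarrow> (\<exists>i<p. p < \<pi> ! i))"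
proof (cases "is_perm \<pi> \<and> \<pi> \<noteq> []")
  case True
  then have perm: "is_perm \<pi>" by simp
  have "(\<exists>\<sigma> \<tau>. is_perm \<sigma> \<and> is_perm \<tau> \<and> \<sigma> \<noteq> [] \<and> \<tau> \<noteq> [] \<and> \<pi> = direct_sum \<sigma> \<tau>)
     \<longleftrightarrow> (\<exists>p. 0 < p \<and> p < length \<pi> \<and> (\<forall>i<p. \<pi> ! i \<le> p))" (is "?L \<longleftrightarrow> ?R")
  proof
    assume ?L
    then obtain \<sigma> \<tau> where st: "is_perm \<sigma>" "is_perm \<tau>" "\<sigma> \<noteq> []" "\<tau> \<noteq> []" "\<pi> = direct_sum \<sigma> \<tau>"
      by blast
    then show ?R
      by (intro exI[of _ "length \<sigma>"]) (auto simp: direct_sum_nth is_perm_nth)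
  next
    assume ?R
    then obtain p where p: "0 < p" "p < length \<pi>" "\<And>i. i < p \<Longrightarrow> \<pi> ! i \<le> p"
      by blast
    obtain \<tau> where "is_perm (take p \<pi>)" "is_perm \<tau>" "length \<tau> = length \<pi> - p"
      "\<pi> = direct_sum (take p \<pi>) \<tau>"
      using prefix_closed_split[OF perm less_imp_le[OF p(2)] p(3)] by blast
    with p(1,2) show ?L
      by (intro exI[of _ "take p \<pi>"] exI[of _ \<tau>]) auto
  qed
  with True show ?thesis
    unfolding indecomposable_def not_less[symmetric] by blast
qed (auto simp: indecomposable_def)

subsection \<open>Counting partitions by their largest staircase\<close>

text \<open>These lists arise as the excess of a sand pile over its largest staircase. The relation
  is not transitive, and \<open>sorted_wrt\<close> imposes it on all pairs of positions, not only on
  neighbours.\<close>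

definition slow_lists :: "nat \<Rightarrow> nat \<Rightarrow> nat list set" where
  "slow_lists n k = {\<nu>. length \<nu> = n \<and> sorted_wrt (\<lambda>x y. y \<le> Suc x) \<nu> \<and> sum_list \<nu> = k}"

definition slow_lists0 :: "nat \<Rightarrow> nat \<Rightarrow> nat list set" where
  "slow_lists0 n k = {\<nu> \<in> slow_lists n k. 0 \<in> set \<nu>}"

lemma finite_slow_lists [simp]: "finite (slow_lists n k)" "finite (slow_lists0 n k)"
proof -
  have "slow_lists n k \<subseteq> {xs. set xs \<subseteq> {..k} \<and> length xs = n}"
    unfolding slow_lists_def by (auto intro: member_le_sum_list)
  then show "finite (slow_lists n k)"
    using finite_lists_length_eq[of "{..k}" n] finite_subset by blast
  then show "finite (slow_lists0 n k)"
    unfolding slow_lists0_def by simp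
qed

lemma sum_list_map_Suc: "sum_list (map Suc xs) = sum_list xs + length xs"
  by (induction xs) auto

text \<open>A list without zeros is \<open>map Suc\<close> of another slow list of the same length,
  with weight smaller by \<open>n\<close>. This recursion is the source of the factor
  \<open>1 / (1 - x^n)\<close>.\<close>

lemma card_slow_lists:
  "card (slow_lists n k) = card (slow_lists0 n k) + (if n \<le> k then card (slow_lists n (k - n)) else 0)"
proof -
  let ?S = "{\<nu> \<in> slow_lists n k. 0 \<notin> set \<nu>}"
  have "?S = (if n \<le> k then map Suc ` slow_lists n (k - n) else {})"
  proof (intro set_eqI iffI)
    fix \<nu> assume \<nu>: "\<nu> \<in> ?S"
    define \<mu> where "\<mu> = map (\<lambda>x. x - 1) \<nu>"
    have "Suc (x - 1) = x" if "x \<in> set \<nu>" for x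
      using \<nu> that by (cases x) auto
    then have eq: "\<nu> = map Suc \<mu>"
      by (simp add: \<mu>_def map_idI)
    have "length \<mu> = n" "sum_list \<mu> + n = k" "sorted_wrt (\<lambda>x y. y \<le> Suc x) \<mu>"
      using \<nu> unfolding slow_lists_def eq by (auto simp: sum_list_map_Suc sorted_wrt_map)
    then show "\<nu> \<in> (if n \<le> k then map Suc ` slow_lists n (k - n) else {})"
      unfolding eq slow_lists_def by auto
  next
    fix \<nu> assume "\<nu> \<in> (if n \<le> k then map Suc ` slow_lists n (k - n) else {})"
    then show "\<nu> \<in> ?S"
      by (auto simp: slow_lists_def sum_list_map_Suc sorted_wrt_map split: if_splits)
  qed
  then have "card ?S = (if n \<le> k then card (slow_lists n (k - n)) else 0)"
    by (simp add: card_image inj_on_def)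
  moreover have "slow_lists n k = slow_lists0 n k \<union> ?S" "slow_lists0 n k \<inter> ?S = {}"
    by (auto simp: slow_lists0_def)
  then have "card (slow_lists n k) = card (slow_lists0 n k) + card ?S"
    by (metis (no_types, lifting) card_Un_disjoint finite_Un finite_slow_lists(1))
  ultimately show ?thesis
    by simp
qed

text \<open>Some entry is zero: either the last one, or an earlier one that bounds the last by 1. A
  final 0 can follow any slow list, whereas a final 1 requires a zero in front of it.\<close>

lemma card_slow_lists0_Suc:
  "card (slow_lists0 (Suc n) k) =
     card (slow_lists n k) + (if k = 0 then 0 else card (slow_lists0 n (k - 1)))"
proof -
  let ?A = "(\<lambda>xs. xs @ [0]) ` slow_lists n k"
  let ?B = "if k = 0 then {} else (\<lambda>xs. xs @ [1]) ` slow_lists0 n (k - 1)"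
  have "slow_lists0 (Suc n) k = ?A \<union> ?B"
  proof (intro set_eqI iffI)
    fix \<nu> assume \<nu>: "\<nu> \<in> slow_lists0 (Suc n) k"
    then have "\<nu> \<noteq> []"
      by (auto simp: slow_lists0_def slow_lists_def)
    then obtain xs a where eq: "\<nu> = xs @ [a]"
      by (metis append_butlast_last_id)
    have xs: "length xs = n" "sum_list xs + a = k" "sorted_wrt (\<lambda>x y. y \<le> Suc x) xs"
        "\<forall>x\<in>set xs. a \<le> Suc x" "0 \<in> set xs \<or> a = 0"
      using \<nu> unfolding slow_lists0_def slow_lists_def eq by (auto simp: sorted_wrt_append)
    then consider "a = 0" | "a = 1" "0 \<in> set xs"
      by fastforce
    then show "\<nu> \<in> ?A \<union> ?B"
      by cases (use xs in \<open>auto simp: eq slow_lists0_def slow_lists_def\<close>)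
  next
    fix \<nu> assume "\<nu> \<in> ?A \<union> ?B"
    then show "\<nu> \<in> slow_lists0 (Suc n) k"
      by (auto simp: slow_lists0_def slow_lists_def sorted_wrt_append split: if_splits)
  qed
  moreover have "?A \<inter> ?B = {}"
    by auto
  moreover have "finite ?A" "finite ?B"
    by simp_all
  ultimately have "card (slow_lists0 (Suc n) k) = card ?A + card ?B"
    by (simp add: card_Un_disjoint del: Un_iff)
  moreover have "card ?A = card (slow_lists n k)"
    by (simp add: card_image inj_on_def)
  moreover have "card ?B = (if k = 0 then 0 else card (slow_lists0 n (k - 1)))"
    by (simp add: card_image inj_on_def)
  ultimately show ?thesis
    by simp
qed

text \<open>With \<open>u\<close> and \<open>v\<close> the series for all slow lists and for those
  with a zero, the two recursions read \<open>u = v (Suc m) + X^(Suc m) * u\<close> and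
  \<open>v (Suc (Suc m)) = u + X * v (Suc m)\<close>. Eliminating \<open>u\<close> yields one new
  factor of the product.\<close>

lemma slow_lists0_gf:
  "Abs_fps (\<lambda>k. of_nat (card (slow_lists0 (Suc m) k))) =
     (\<Prod>i = 1..m. (fps_X + 1 / (1 - fps_X ^ i) :: rat fps))"
proof (induction m)
  case 0
  \<comment> \<open>In length 1 only \<open>[0]\<close> contains a zero, so the series is 1, the
    empty product.\<close>
  have "slow_lists0 0 k = {}" "slow_lists 0 k = (if k = 0 then {[]} else {})" for k
    by (auto simp: slow_lists0_def slow_lists_def)
  then show ?case
    by (simp add: card_slow_lists0_Suc fps_eq_iff)
next
  case (Suc m)
  define u where "u = Abs_fps (\<lambda>k. of_nat (card (slow_lists (Suc m) k)) :: rat)"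
  define v where "v n = Abs_fps (\<lambda>k. of_nat (card (slow_lists0 n k)) :: rat)" for n
  have "u = v (Suc m) + fps_X ^ Suc m * u"
    by (rule fps_ext, unfold fps_add_nth fps_X_power_mult_nth u_def v_def fps_nth_Abs_fps,
        subst card_slow_lists) auto
  then have "u * (1 - fps_X ^ Suc m) = v (Suc m)"
    by (simp add: algebra_simps)
  moreover have "fps_nth (1 - fps_X ^ Suc m :: rat fps) 0 \<noteq> 0"
    by simp
  ultimately have u: "u = v (Suc m) * (1 / (1 - fps_X ^ Suc m))"
    by (metis (no_types, lifting) fps_divide_unit inverse_mult_eq_1' mult.assoc mult.right_neutral mult_1)
  have "v (Suc (Suc m)) = u + fps_X * v (Suc m)"
    by (rule fps_ext, unfold fps_add_nth fps_X_mult_nth u_def v_def fps_nth_Abs_fps,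
        subst card_slow_lists0_Suc) auto
  also have "\<dots> = v (Suc m) * (fps_X + 1 / (1 - fps_X ^ Suc m))"
    by (subst u) (simp add: algebra_simps)
  finally have "v (Suc (Suc m)) = v (Suc m) * (fps_X + 1 / (1 - fps_X ^ Suc m))" .
  then show ?case
    using Suc.IH unfolding v_def by simp
qed

section \<open>Splitting a sand pile into its largest staircase and a slow list\<close>

text \<open>The closed description of the sand pile model, identified with \<open>SPM k\<close> in
  \<open>SPM_eq_sand_piles\<close>. Weak monotonicity is contained in the inequality, because
  \<open>j\<close> exceeds \<open>i\<close> by at least 1.\<close>

definition sand_piles :: "nat \<Rightarrow> nat list set" where
  "sand_piles k = {xs. (\<forall>x \<in> set xs. 0 < x) \<and> sum_list xs = k \<and>
     (\<forall>i j. i < j \<and> j < length xs \<longrightarrow> xs ! j + j \<le> Suc (xs ! i + i))}"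

text \<open>Padding by zeros lets lists of different lengths be compared at every position, and
  turns the creation of a new part into a pointwise update.\<close>

definition part :: "nat list \<Rightarrow> nat \<Rightarrow> nat" where
  "part xs i = (if i < length xs then xs ! i else 0)"

lemma part_inject:
  assumes "\<forall>x \<in> set xs. 0 < x" "\<forall>x \<in> set ys. 0 < x" "\<And>i. part xs i = part ys i"
  shows "xs = ys"
proof (rule nth_equalityI)
  have pos: "part zs i > 0 \<longleftrightarrow> i < length zs" if "\<forall>x \<in> set zs. 0 < x" for zs i
    using that by (auto simp: part_def)
  have *: "i < length xs \<longleftrightarrow> i < length ys" for i
    using pos[OF assms(1), of i] pos[OF assms(2), of i] assms(3)[of i] by simp
  show len: "length xs = length ys"
    using *[of "length xs"] *[of "length ys"] by simp
  show "xs ! i = ys ! i" if "i < length xs" for i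
    using assms(3)[of i] that len by (simp add: part_def)
qed

text \<open>The largest \<open>m\<close> such that part \<open>i\<close> is at least
  \<open>m - i\<close> for every \<open>i\<close>. The padding takes part in the minimum: position
  \<open>length xs\<close> contributes its own index, so the staircase has no more rows than the
  partition.\<close>

definition stair :: "nat list \<Rightarrow> nat" where
  "stair xs = Inf (range (\<lambda>i. part xs i + i))"

lemma stair_le: "stair xs \<le> part xs i + i"
  unfolding stair_def by (intro cINF_lower) auto

lemma stair_attained: obtains i where "part xs i + i = stair xs"
proof -
  have "stair xs \<in> range (\<lambda>i. part xs i + i)"
    unfolding stair_def by (rule Inf_nat_def1) auto
  then show ?thesis
    using that by force
qed

lemma stair_eqI:
  assumes "\<And>i. m \<le> part xs i + i" "part xs i + i = m"
  shows "stair xs = m"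
proof (rule antisym)
  show "stair xs \<le> m"
    using stair_le[of xs i] assms(2) by simp
  show "m \<le> stair xs"
    using stair_attained[of xs] assms(1) by metis
qed

lemma sand_piles_part:
  assumes "xs \<in> sand_piles k" "i < j" "0 < part xs j"
  shows "part xs j + j \<le> Suc (part xs i + i)"
  using assms by (auto simp: sand_piles_def part_def split: if_splits)

text \<open>The minimum is attained at some \<open>i0\<close> not exceeding \<open>stair xs\<close>.
  A nonzero part at a later \<open>i\<close> would satisfy
  \<open>part xs i + i \<le> Suc (stair xs)\<close>, which is impossible for
  \<open>i > stair xs\<close>.\<close>

lemma part_eq_0_above_stair:
  assumes "xs \<in> sand_piles k" "stair xs < i"
  shows "part xs i = 0"
proof (rule ccontr)
  assume nz: "part xs i \<noteq> 0"
  obtain i0 where i0: "part xs i0 + i0 = stair xs"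
    by (rule stair_attained)
  then have "i0 < i"
    using assms(2) by linarith
  then have "part xs i + i \<le> Suc (stair xs)"
    using sand_piles_part[OF assms(1)] nz i0 by (metis gr0I)
  then show False
    using nz assms(2) by linarith
qed

lemma length_le_stair:
  assumes "xs \<in> sand_piles k"
  shows "length xs \<le> Suc (stair xs)"
proof (rule ccontr)
  assume "\<not> length xs \<le> Suc (stair xs)"
  then have *: "Suc (stair xs) < length xs" by simp
  then have "xs ! Suc (stair xs) > 0"
    using assms by (auto simp: sand_piles_def)
  then show False
    using part_eq_0_above_stair[OF assms, of "Suc (stair xs)"] * by (simp add: part_def)
qed

lemma sum_part:
  assumes "length xs \<le> n"
  shows "(\<Sum>i<n. part xs i) = sum_list xs"
proof -
  have "(\<Sum>i<n. part xs i) = (\<Sum>i<length xs. part xs i)"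
    using assms by (intro sum.mono_neutral_right) (auto simp: part_def)
  also have "\<dots> = sum_list xs"
    by (simp add: part_def sum_list_sum_nth atLeast0LessThan)
  finally show ?thesis .
qed

lemma sum_staircase: "(\<Sum>i<Suc m. m - i) = m * (m + 1) div 2"
proof -
  have "(\<Sum>i<Suc m. m - i) = (\<Sum>i<Suc m. i)"
    by (rule sum.reindex_bij_witness[of _ "\<lambda>i. m - i" "\<lambda>i. m - i"]) auto
  then show ?thesis
    using gauss_sum_nat[of m] by (simp only: lessThan_Suc_atMost atMost_atLeast0) simp
qed

text \<open>By \<open>stair_le\<close> no subtraction is truncated. The list has one entry more than
  the staircase has rows, because one part can still stand just below the staircase.\<close>

definition excess :: "nat list \<Rightarrow> nat list" where
  "excess xs = map (\<lambda>i. part xs i + i - stair xs) [0..<Suc (stair xs)]"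

lemma sum_list_excess:
  assumes "xs \<in> sand_piles k"
  shows "sum_list (excess xs) + stair xs * (stair xs + 1) div 2 = k"
proof -
  let ?m = "stair xs"
  have "sum_list (excess xs) = (\<Sum>i<Suc ?m. part xs i + i - ?m)"
    unfolding excess_def by (simp only: interv_sum_list_conv_sum_set_nat set_upt atLeast0LessThan)
  then have "sum_list (excess xs) + ?m * (?m + 1) div 2 =
      (\<Sum>i<Suc ?m. (part xs i + i - ?m) + (?m - i))"
    unfolding sum_staircase[symmetric] sum.distrib by simp
  also have "\<dots> = (\<Sum>i<Suc ?m. part xs i)"
  proof (rule sum.cong)
    fix i assume "i \<in> {..<Suc ?m}"
    then show "(part xs i + i - ?m) + (?m - i) = part xs i"
      using stair_le[of xs i] by simp
  qed simp
  also have "\<dots> = k"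
    using sum_part[OF length_le_stair[OF assms]] assms by (simp add: sand_piles_def)
  finally show ?thesis .
qed

lemma excess_mem:
  assumes "xs \<in> sand_piles k"
  shows "excess xs \<in> slow_lists0 (Suc (stair xs)) (k - stair xs * (stair xs + 1) div 2)"
proof -
  let ?m = "stair xs"
  have nth: "excess xs ! i = part xs i + i - ?m" if "i < Suc ?m" for i
    using that unfolding excess_def by (simp del: upt_Suc)
  have len: "length (excess xs) = Suc ?m"
    by (simp add: excess_def)
  have "excess xs ! j \<le> Suc (excess xs ! i)" if "i < j" "j < Suc ?m" for i j
  \<comment> \<open>Slowness speaks only about nonzero parts. At a zero part with
    \<open>j \<le> stair xs\<close> the excess is 0, so the bound is immediate.\<close>
  proof (cases "part xs j = 0")
    case True
    then show ?thesis
      using that by (simp add: nth)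
  next
    case False
    then show ?thesis
      using sand_piles_part[OF assms that(1)] that stair_le[of xs i] by (simp add: nth)
  qed
  then have "sorted_wrt (\<lambda>x y. y \<le> Suc x) (excess xs)"
    by (simp add: sorted_wrt_iff_nth_less len)
  moreover obtain i0 where i0: "part xs i0 + i0 = ?m"
    by (rule stair_attained)
  then have "excess xs ! i0 = 0" "i0 < Suc ?m"
    by (simp_all add: nth)
  then have "0 \<in> set (excess xs)"
    by (metis len nth_mem)
  ultimately show ?thesis
    using len sum_list_excess[OF assms] by (auto simp: slow_lists0_def slow_lists_def)
qed

text \<open>The length of the excess gives the staircase, adding the staircase back gives the parts
  up to \<open>stair xs\<close>, and all later parts vanish.\<close>

lemma excess_inject:
  assumes "xs \<in> sand_piles k" "ys \<in> sand_piles k" "excess xs = excess ys"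
  shows "xs = ys"
proof (rule part_inject)
  have m: "stair xs = stair ys"
    using arg_cong[OF assms(3), of length] by (simp add: excess_def)
  show "part xs i = part ys i" for i
  proof (cases "i \<le> stair xs")
    case True
    then have "part xs i + i - stair xs = part ys i + i - stair ys"
      using arg_cong[OF assms(3), of "\<lambda>l. l ! i"] m unfolding excess_def by (simp del: upt_Suc)
    then show ?thesis
      using stair_le[of xs i] stair_le[of ys i] m by simp
  next
    case False
    then show ?thesis
      using part_eq_0_above_stair assms m by simp
  qed
qed (use assms in \<open>auto simp: sand_piles_def\<close>)

lemma excess_surj:
  assumes \<nu>: "\<nu> \<in> slow_lists0 (Suc m) (k - m * (m + 1) div 2)" and k: "m * (m + 1) div 2 \<le> k"
  obtains xs where "xs \<in> sand_piles k" "stair xs = m" "excess xs = \<nu>"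
proof
  have len: "length \<nu> = Suc m" and sum: "sum_list \<nu> = k - m * (m + 1) div 2"
    and zero: "0 \<in> set \<nu>"
    and slow: "\<And>i j. i < j \<Longrightarrow> j < Suc m \<Longrightarrow> \<nu> ! j \<le> Suc (\<nu> ! i)"
    using \<nu> by (auto simp: slow_lists0_def slow_lists_def sorted_wrt_iff_nth_less)
  obtain i0 where i0: "i0 < Suc m" "\<nu> ! i0 = 0"
    using zero len by (metis in_set_conv_nth)
  have last: "\<nu> ! m \<le> 1"
    using i0 slow[of i0 m] by (cases "i0 = m") auto
  \<comment> \<open>Adding the staircase makes every position below \<open>m\<close> positive.
    Position \<open>m\<close> gains nothing, and its entry is 0 or 1, so it is a part exactly when
    that entry is 1.\<close>
  let ?xs = "map (\<lambda>i. \<nu> ! i + (m - i)) [0..<m] @ (if \<nu> ! m = 0 then [] else [1])"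
  have part: "part ?xs i = (if i \<le> m then \<nu> ! i + (m - i) else 0)" for i
    using last by (auto simp: part_def nth_append)
  have lenxs: "length ?xs \<le> Suc m"
    by simp
  have pos: "\<forall>x \<in> set ?xs. 0 < x"
    by auto
  have slow': "part ?xs j + j \<le> Suc (part ?xs i + i)" if "i < j" "j < length ?xs" for i j
    using that slow[of i j] lenxs unfolding part by auto
  have "sum_list ?xs = (\<Sum>i<Suc m. part ?xs i)"
    using sum_part[OF lenxs] by simp
  also have "\<dots> = (\<Sum>i<Suc m. \<nu> ! i + (m - i))"
    by (rule sum.cong) (auto simp: part)
  also have "\<dots> = sum_list \<nu> + m * (m + 1) div 2"
    unfolding sum.distrib sum_staircase using len by (simp add: sum_list_sum_nth atLeast0LessThan)
  also have "\<dots> = k"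
    using sum k by simp
  finally have "sum_list ?xs = k" .
  moreover have "?xs ! j + j \<le> Suc (?xs ! i + i)" if "i < j" "j < length ?xs" for i j
    using slow'[OF that] that by (simp add: part_def)
  ultimately show "?xs \<in> sand_piles k"
    using pos unfolding sand_piles_def by blast
  \<comment> \<open>The zero of \<open>\<nu>\<close> at \<open>i0\<close> is where the minimum is
    attained.\<close>
  show stair: "stair ?xs = m"
    by (rule stair_eqI[of m _ i0]) (use i0 in \<open>auto simp: part\<close>)
  show "excess ?xs = \<nu>"
    unfolding excess_def stair part by (rule nth_equalityI) (simp_all add: len del: upt_Suc)
qed

text \<open>The pair of staircase and excess determines a sand pile, and every slow list with a zero
  and the remaining weight occurs as an excess.\<close>

lemma card_sand_piles:
  "finite (sand_piles k)"
  "card (sand_piles k) =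
     (\<Sum>m | m * (m + 1) div 2 \<le> k. card (slow_lists0 (Suc m) (k - m * (m + 1) div 2)))"
proof -
  let ?M = "{m. m * (m + 1) div 2 \<le> k}"
  have "?M \<subseteq> {..k}"
  proof
    fix m assume "m \<in> ?M"
    moreover have "m \<le> m * (m + 1) div 2"
      by (cases m) auto
    ultimately show "m \<in> {..k}"
      by simp
  qed
  then have fin: "finite ?M"
    using finite_subset by blast
  let ?S = "SIGMA m : ?M. slow_lists0 (Suc m) (k - m * (m + 1) div 2)"
  have "bij_betw (\<lambda>xs. (stair xs, excess xs)) (sand_piles k) ?S"
    unfolding bij_betw_def
  proof (intro conjI inj_onI subset_antisym subsetI)
    fix xs ys
    assume "xs \<in> sand_piles k" "ys \<in> sand_piles k" "(stair xs, excess xs) = (stair ys, excess ys)"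
    then show "xs = ys"
      using excess_inject by blast
  next
    fix z assume "z \<in> (\<lambda>xs. (stair xs, excess xs)) ` sand_piles k"
    then obtain xs where xs: "xs \<in> sand_piles k" and z: "z = (stair xs, excess xs)"
      by blast
    then show "z \<in> ?S"
      using excess_mem[OF xs] sum_list_excess[OF xs] by auto
  next
    fix z assume "z \<in> ?S"
    then obtain m \<nu> where "z = (m, \<nu>)" "m * (m + 1) div 2 \<le> k"
        "\<nu> \<in> slow_lists0 (Suc m) (k - m * (m + 1) div 2)"
      by blast
    then show "z \<in> (\<lambda>xs. (stair xs, excess xs)) ` sand_piles k"
      using excess_surj by (metis (no_types, lifting) rev_image_eqI)
  qed
  then show "finite (sand_piles k)" "card (sand_piles k) =
     (\<Sum>m\<in>?M. card (slow_lists0 (Suc m) (k - m * (m + 1) div 2)))"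
    using fin by (auto dest: bij_betw_finite bij_betw_same_card)
qed

text \<open>\<open>T m\<close> is the series of the sand piles with staircase \<open>m\<close>. It
  starts in degree \<open>m * (m + 1) div 2\<close>, which is at least \<open>m\<close>, so the
  coefficient of degree \<open>n\<close> is constant from the \<open>n\<close>-th partial sum on.
  The term \<open>T 0 = 1\<close>, for staircase 0, accounts for the subtracted 1.\<close>

lemma sand_piles_gf:
  fixes T :: "nat \<Rightarrow> rat fps"
  defines "T \<equiv> \<lambda>k. fps_X ^ (k * (k + 1) div 2) * (\<Prod>i = 1..k. (fps_X + 1 / (1 - fps_X ^ i)))"
  shows "(\<lambda>k. T (Suc k)) sums (Abs_fps (\<lambda>k. of_nat (card (sand_piles k))) - 1)"
  unfolding sums_def
proof (rule tendsto_fpsI)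
  fix n
  have coeff: "fps_nth (T m) n = (if m * (m + 1) div 2 \<le> n
      then of_nat (card (slow_lists0 (Suc m) (n - m * (m + 1) div 2))) else 0)" for m
    unfolding T_def slow_lists0_gf[symmetric] by (auto simp: fps_X_power_mult_nth)
  have tri: "m \<le> m * (m + 1) div 2" for m :: nat
    by (cases m) auto
  have "fps_nth (\<Sum>k<N. T (Suc k)) n = fps_nth (Abs_fps (\<lambda>k. of_nat (card (sand_piles k))) - 1) n"
    if "N \<ge> n" for N
  proof -
    have "(of_nat (card (sand_piles n)) :: rat) = (\<Sum>m | m * (m + 1) div 2 \<le> n. fps_nth (T m) n)"
      unfolding card_sand_piles(2) by (simp add: coeff)
    also have "\<dots> = (\<Sum>m<Suc N. fps_nth (T m) n)"
    proof (rule sum.mono_neutral_left)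
      show "{m. m * (m + 1) div 2 \<le> n} \<subseteq> {..<Suc N}"
        using tri that by (auto intro: le_trans less_Suc_eq_le[THEN iffD2])
    qed (auto simp: coeff)
    also have "\<dots> = fps_nth (T 0) n + (\<Sum>k<N. fps_nth (T (Suc k)) n)"
      by (rule sum.lessThan_Suc_shift)
    also have "T 0 = 1"
      by (simp add: T_def)
    finally show ?thesis
      by (simp add: fps_sum_nth)
  qed
  then show "\<forall>\<^sub>F N in sequentially. fps_nth (\<Sum>k<N. T (Suc k)) n =
      fps_nth (Abs_fps (\<lambda>k. of_nat (card (sand_piles k))) - 1) n"
    unfolding eventually_sequentially by blast
qed

subsection \<open>The sand pile model\<close>

text \<open>The inequality of \<open>sand_piles\<close> for zero padded sequences. The guard
  \<open>0 < f j\<close> exempts the padding, where \<open>f j + j\<close> grows without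
  bound.\<close>

definition slow :: "(nat \<Rightarrow> nat) \<Rightarrow> bool" where
  "slow f \<longleftrightarrow> (\<forall>i j. i < j \<and> 0 < f j \<longrightarrow> f j + j \<le> Suc (f i + i))"

lemma sand_piles_iff_slow:
  "xs \<in> sand_piles k \<longleftrightarrow> (\<forall>x \<in> set xs. 0 < x) \<and> sum_list xs = k \<and> slow (part xs)"
proof -
  have "slow (part xs) \<longleftrightarrow> (\<forall>i j. i < j \<and> j < length xs \<longrightarrow> xs ! j + j \<le> Suc (xs ! i + i))"
    if "\<forall>x \<in> set xs. 0 < x"
    using that by (auto simp: slow_def part_def)
  then show ?thesis
    unfolding sand_piles_def by blast
qed

text \<open>The value \<open>f i + i\<close> drops by 1 at \<open>p\<close> and rises by 1 at
  \<open>Suc p\<close>. Since \<open>Suc b \<le> a\<close>, the new value at \<open>Suc p\<close> is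
  at most the old one at \<open>p\<close>, which bounds it against earlier positions; dually,
  positions after \<open>Suc p\<close> are compared with \<open>p\<close> through the old value at
  \<open>Suc p\<close>.\<close>

lemma slow_move:
  assumes "slow f" "f p = Suc a" "f (Suc p) = b" "Suc b \<le> a"
  shows "slow (f(p := a, Suc p := Suc b))"
  unfolding slow_def
proof (intro allI impI)
  fix i j
  let ?g = "f(p := a, Suc p := Suc b)"
  assume ij: "i < j \<and> 0 < ?g j"
  have f: "f j + j \<le> Suc (f i + i)" if "i < j" "0 < f j" for i j
    using assms(1) that by (auto simp: slow_def)
  consider "j = Suc p" "i = p" | "j = Suc p" "i < p" | "j = p" | "j > Suc p" "i = p" | "j > Suc p" "i = Suc p"
    | "j > Suc p" "i < p" | "j > Suc p" "i > Suc p" | "j < p"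
    using ij by linarith
  then show "?g j + j \<le> Suc (?g i + i)"
  proof cases
    case 2
    then show ?thesis using f[of i p] assms by simp
  next
    case 3
    then show ?thesis using f[of i p] assms ij by (simp split: if_splits)
  next
    case 4
    then show ?thesis using f[of "Suc p" j] assms ij by (simp split: if_splits)
  next
    case 5
    then show ?thesis using f[of i j] assms ij by (simp split: if_splits)
  qed (use f[of i j] assms ij in \<open>auto split: if_splits\<close>)
qed

text \<open>The reverse move raises \<open>f i + i\<close> by 1 at \<open>p\<close> and lowers it by
  1 at \<open>Suc p\<close>. The last two hypotheses say that the inequality has a unit to spare
  against positions before \<open>p\<close> and after \<open>Suc p\<close>, which is what this
  consumes.\<close>

lemma slow_unmove:
  assumes "slow f" "0 < f (Suc p)"
    and "\<And>j. Suc p < j \<Longrightarrow> 0 < f j \<Longrightarrow> f j + j \<le> f (Suc p) + Suc p"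
    and "\<And>i. i < p \<Longrightarrow> f p + p \<le> f i + i"
  shows "slow (f(p := Suc (f p), Suc p := f (Suc p) - 1))"
  unfolding slow_def
proof (intro allI impI)
  fix i j
  let ?g = "f(p := Suc (f p), Suc p := f (Suc p) - 1)"
  assume ij: "i < j \<and> 0 < ?g j"
  have f: "f j + j \<le> Suc (f i + i)" if "i < j" "0 < f j" for i j
    using assms(1) that by (auto simp: slow_def)
  consider "j = Suc p" "i = p" | "j = Suc p" "i < p" | "j = p" | "j > Suc p" "i = p" | "j > Suc p" "i = Suc p"
    | "j > Suc p" "i < p" | "j > Suc p" "i > Suc p" | "j < p"
    using ij by linarith
  then show "?g j + j \<le> Suc (?g i + i)"
  proof cases
    case 3
    then show ?thesis using assms(4)[of i] ij by (simp split: if_splits)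
  next
    case 5
    then show ?thesis using assms(2) assms(3)[of j] ij by (simp split: if_splits)
  qed (use f[of i j] assms(2) ij in \<open>auto split: if_splits\<close>)
qed

text \<open>Slowness is invariant under moves. That the result is a partition provides
  \<open>Suc b \<le> a\<close>, and the creation of a new part is the case \<open>b = 0\<close> in
  the padding.\<close>

lemma SPM_subset_sand_piles: "xs \<in> SPM k \<Longrightarrow> xs \<in> sand_piles k"
proof (induction rule: SPM.induct)
  case empty
  then show ?case by (simp add: sand_piles_def)
next
  case one_part
  then show ?case by (simp add: sand_piles_def)
next
  case (move xs a b ys)
  let ?old = "xs @ Suc a # b # ys" and ?new = "xs @ a # Suc b # ys" and ?p = "length xs"
  have "part ?new = (part ?old)(?p := a, Suc ?p := Suc b)"
    by (auto simp: fun_eq_iff part_def nth_append nth_Cons split: nat.splits)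
  moreover have "Suc b \<le> a"
    using move.hyps by (simp add: is_partition_def sorted_wrt_append)
  moreover have "slow (part ?old)"
    using move.IH by (simp add: sand_piles_iff_slow)
  ultimately have "slow (part ?new)"
    using slow_move[of "part ?old" ?p a b] by (simp add: part_def nth_append)
  then show ?case
    using move.IH move.hyps by (simp add: sand_piles_iff_slow is_partition_def)
next
  case (new_part xs a)
  let ?old = "xs @ [Suc a]" and ?new = "xs @ [a, 1]" and ?p = "length xs"
  have "part ?new = (part ?old)(?p := a, Suc ?p := Suc 0)"
    by (auto simp: fun_eq_iff part_def nth_append nth_Cons split: nat.splits)
  moreover have "Suc 0 \<le> a"
    using new_part.hyps by (simp add: is_partition_def sorted_wrt_append)
  moreover have "slow (part ?old)"
    using new_part.IH by (simp add: sand_piles_iff_slow)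
  ultimately have "slow (part ?new)"
    using slow_move[of "part ?old" ?p a 0] by (simp add: part_def nth_append)
  then show ?case
    using new_part.IH new_part.hyps by (simp add: sand_piles_iff_slow is_partition_def)
qed

lemma sand_piles_is_partition:
  assumes "xs \<in> sand_piles k"
  shows "is_partition xs"
proof -
  have "xs ! j \<le> xs ! i" if "i < j" "j < length xs" for i j
  proof -
    have "xs ! j + j \<le> Suc (xs ! i + i)"
      using assms that by (simp add: sand_piles_def)
    then show ?thesis
      using that by linarith
  qed
  then show ?thesis
    using assms by (simp add: is_partition_def sorted_wrt_iff_nth_less sand_piles_def)
qed

section \<open>Undoing sand pile moves\<close>

text \<open>The sum of \<open>i * xs ! i\<close>, with positions counted from 0. Every move raises
  it by 1, so it serves as the termination measure for moving grains back.\<close>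

fun moment :: "nat list \<Rightarrow> nat" where
  "moment [] = 0"
| "moment (x # xs) = moment xs + sum_list xs"

lemma moment_move: "moment (us @ Suc c # e # ys) < moment (us @ c # Suc e # ys)"
  by (induction us) auto

lemma moment_new_part: "moment (us @ [Suc c]) < moment (us @ [c, 1])"
  by (induction us) auto

text \<open>A grain can be moved back from position \<open>q\<close>, the first position \<open>q \<ge> 1\<close> at which
  \<open>xs ! q + q\<close> is maximal.\<close>

lemma sand_piles_predecessor:
  assumes xs: "xs \<in> sand_piles k" and len: "2 \<le> length xs"
  obtains p where "Suc p < length xs"
    "slow ((part xs)(p := Suc (part xs p), Suc p := part xs (Suc p) - 1))"
    "part xs (Suc p) = 1 \<Longrightarrow> length xs = Suc (Suc p)"
proof -
  let ?f = "part xs"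
  have slow: "?f j + j \<le> Suc (?f i + i)" if "i < j" "0 < ?f j" for i j
    using xs that by (simp add: sand_piles_iff_slow slow_def)
  have pos: "0 < ?f i \<longleftrightarrow> i < length xs" for i
    using xs by (auto simp: sand_piles_def part_def)
  let ?Q = "{1..<length xs}"
  define M where "M = Max ((\<lambda>i. ?f i + i) ` ?Q)"
  have ne: "?Q \<noteq> {}"
    using len by simp
  have M_ge: "?f i + i \<le> M" if "i \<in> ?Q" for i
    unfolding M_def using that by simp
  have "M \<in> (\<lambda>i. ?f i + i) ` ?Q"
    unfolding M_def using ne by (intro Max_in) auto
  then have ex: "\<exists>q. q \<in> ?Q \<and> ?f q + q = M"
    by blast
  define q where "q = (LEAST q. q \<in> ?Q \<and> ?f q + q = M)"
  have q: "q \<in> ?Q" "?f q + q = M"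
    using LeastI_ex[OF ex] unfolding q_def by blast+
  have q_least: "?f i + i < M" if "1 \<le> i" "i < q" for i
  proof -
    have "i \<in> ?Q"
      using that q by simp
    then show ?thesis
      using not_less_Least[of i "\<lambda>q. q \<in> ?Q \<and> ?f q + q = M"] that(2) M_ge[of i]
      unfolding q_def by fastforce
  qed
  obtain p where p: "q = Suc p"
    using q(1) by (cases q) auto
  show ?thesis
  proof (rule that[of p])
    show "Suc p < length xs"
      using q p by simp
    show "slow (?f(p := Suc (?f p), Suc p := ?f (Suc p) - 1))"
    proof (rule slow_unmove)
      show "slow ?f"
        using xs by (simp add: sand_piles_iff_slow)
      show "0 < ?f (Suc p)"
        using pos q p by simp
      show "?f j + j \<le> ?f (Suc p) + Suc p" if "Suc p < j" "0 < ?f j" for j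
        using M_ge[of j] that pos[of j] q p by simp
      \<comment> \<open>From \<open>i < p\<close> follows \<open>1 \<le> p\<close>, so minimality of
        \<open>q\<close> gives \<open>?f p + p < M\<close>, while slowness at \<open>q\<close> gives
        \<open>M \<le> Suc (?f i + i)\<close>.\<close>
      show "?f p + p \<le> ?f i + i" if "i < p" for i
        using q_least[of p] slow[of i q] that pos[of q] q p by simp
    qed
    \<comment> \<open>If part \<open>q\<close> is 1, then \<open>M = q + 1\<close>. A further part
      would contribute at least \<open>q + 2\<close>, beyond the maximum, so removing part
      \<open>q\<close> leaves no gap.\<close>
    show "length xs = Suc (Suc p)" if "?f (Suc p) = 1"
    proof (rule ccontr)
      assume "length xs \<noteq> Suc (Suc p)"
      then have "Suc q < length xs"
        using q p by simp
      then show False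
        using M_ge[of "Suc q"] pos[of "Suc q"] that q p by simp
    qed
  qed
qed

text \<open>Moving a grain back stays inside \<open>sand_piles k\<close> and lowers the moment, so
  by induction the predecessor lies in \<open>SPM k\<close>; moving the grain forward again is a
  legal step because \<open>xs\<close> is a partition.\<close>

lemma sand_piles_subset_SPM: "xs \<in> sand_piles k \<Longrightarrow> xs \<in> SPM k"
proof (induction "moment xs" arbitrary: xs rule: less_induct)
  case less
  have part: "is_partition xs"
    using less.prems by (rule sand_piles_is_partition)
  show ?case
  proof (cases "2 \<le> length xs")
    case False
    \<comment> \<open>\<open>remdups_adj.cases\<close> distinguishes empty, one-element and longer
      lists.\<close>
    then consider "xs = []" | x where "xs = [x]"
      by (cases xs rule: remdups_adj.cases) auto
    then show ?thesis
      by cases (use less.prems in \<open>auto simp: sand_piles_def intro: SPM.intros\<close>)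
  next
    case True
    obtain p where p: "Suc p < length xs"
      and slow: "slow ((part xs)(p := Suc (part xs p), Suc p := part xs (Suc p) - 1))"
      and end1: "part xs (Suc p) = 1 \<Longrightarrow> length xs = Suc (Suc p)"
      by (rule sand_piles_predecessor[OF less.prems True]) blast
    define us c d ys where "us = take p xs" and "c = xs ! p" and "d = xs ! Suc p"
      and "ys = drop (Suc (Suc p)) xs"
    have xs: "xs = us @ c # d # ys"
      unfolding us_def c_def d_def ys_def using p
      by (simp add: Cons_nth_drop_Suc)
    have lenus: "length us = p"
      using p by (simp add: us_def)
    have pos: "\<forall>x \<in> set xs. 0 < x" and sum: "sum_list xs = k"
      using less.prems by (simp_all add: sand_piles_def)
    have "d > 0"
      using pos by (simp add: xs)
    show ?thesis
    \<comment> \<open>A grain that forms the last part alone was created by \<open>new_part\<close>;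
      any other one was added to an existing part by \<open>move\<close>.\<close>
    proof (cases "d = 1")
      case True
      then have "ys = []"
        using end1 p unfolding ys_def d_def by (simp add: part_def)
      with True have xs': "xs = us @ [c, 1]"
        by (simp add: xs)
      let ?old = "us @ [Suc c]"
      have "part ?old = (part xs)(p := Suc (part xs p), Suc p := part xs (Suc p) - 1)"
        by (auto simp: xs' lenus[symmetric] fun_eq_iff part_def nth_append nth_Cons split: nat.splits)
      then have "?old \<in> sand_piles k"
        using slow pos sum by (simp add: sand_piles_iff_slow xs')
      then have "?old \<in> SPM k"
        using less.hyps[of ?old] moment_new_part[of us c] by (simp add: xs')
      then show ?thesis
        using SPM.new_part part unfolding xs' by blast
    next
      case False
      then obtain e where e: "d = Suc e" "0 < e"
        using \<open>d > 0\<close> by (cases d) auto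
      let ?old = "us @ Suc c # e # ys"
      have "part ?old = (part xs)(p := Suc (part xs p), Suc p := part xs (Suc p) - 1)"
        by (auto simp: xs e lenus[symmetric] fun_eq_iff part_def nth_append nth_Cons split: nat.splits)
      then have "?old \<in> sand_piles k"
        using slow pos sum e(2) by (simp add: sand_piles_iff_slow xs e(1))
      then have "?old \<in> SPM k"
        using less.hyps[of ?old] moment_move[of us c e ys] by (simp add: xs e(1))
      then show ?thesis
        using SPM.move part unfolding xs e(1) by blast
    qed
  qed
qed

lemma SPM_eq_sand_piles: "SPM k = sand_piles k"
  using SPM_subset_sand_piles sand_piles_subset_SPM by blast

subsection \<open>Lehmer codes\<close>

fun code :: "nat list \<Rightarrow> nat list" where
  "code [] = []"
| "code (x # xs) = length (filter (\<lambda>y. y < x) xs) # code xs"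

lemma length_code [simp]: "length (code xs) = length xs"
  by (induction xs) auto

lemma code_nth:
  "i < length xs \<Longrightarrow> code xs ! i = card {j. i < j \<and> j < length xs \<and> xs ! j < xs ! i}"
proof (induction xs arbitrary: i)
  case (Cons x xs)
  show ?case
  proof (cases i)
    case 0
    have "{j. i < j \<and> j < length (x # xs) \<and> (x # xs) ! j < (x # xs) ! i} =
        Suc ` {j. j < length xs \<and> xs ! j < x}"
      using 0 by (auto simp: image_iff gr0_conv_Suc)
    then show ?thesis
      using 0 by (simp add: card_image length_filter_conv_card)
  next
    case (Suc i')
    have "{j. i < j \<and> j < length (x # xs) \<and> (x # xs) ! j < (x # xs) ! i} =
        Suc ` {j. i' < j \<and> j < length xs \<and> xs ! j < xs ! i'}"
      using Suc by (auto simp: image_iff Suc_less_eq2)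
    then show ?thesis
      using Suc Cons by (simp add: card_image)
  qed
qed simp

lemma sum_list_code: "sum_list (code xs) = card (inversions xs)"
proof -
  have "inversions xs = (SIGMA i : {..<length xs}. {j. i < j \<and> j < length xs \<and> xs ! j < xs ! i})"
    by (auto simp: inversions_def)
  then have "card (inversions xs) = (\<Sum>i<length xs. code xs ! i)"
    by (simp add: code_nth)
  also have "\<dots> = sum_list (code xs)"
    by (simp add: sum_list_sum_nth atLeast0LessThan)
  finally show ?thesis ..
qed

text \<open>Rank is strictly increasing on \<open>A\<close>, hence injective into an interval of the
  same size. It converts between the head of a code and the head of the list.\<close>

lemma bij_betw_rank:
  fixes A :: "nat set"
  assumes "finite A"
  shows "bij_betw (\<lambda>x. card {z \<in> A. z < x}) A {..<card A}"
proof -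
  let ?r = "\<lambda>x. card {z \<in> A. z < x}"
  have less: "?r x < ?r y" if "x \<in> A" "x < y" for x y
    by (rule psubset_card_mono) (use assms that in auto)
  have "inj_on ?r A"
    by (rule linorder_inj_onI) (use less in fastforce)+
  moreover have "?r ` A \<subseteq> {..<card A}"
    using assms by (auto intro!: psubset_card_mono)
  ultimately have "?r ` A = {..<card A}"
    by (intro card_subset_eq) (simp_all add: card_image)
  with \<open>inj_on ?r A\<close> show ?thesis
    by (simp add: bij_betw_def)
qed

lemma hd_code:
  fixes x :: nat
  assumes "distinct (x # xs)"
  shows "length (filter (\<lambda>y. y < x) xs) = card {z \<in> set (x # xs). z < x}"
proof -
  have "{z \<in> set (x # xs). z < x} = set (filter (\<lambda>y. y < x) xs)"
    by auto
  then show ?thesis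
    using assms by (simp add: distinct_card[symmetric])
qed

text \<open>Each code entry is the rank of the list entry within the set of values still available,
  so the list can be read off from left to right.\<close>

lemma code_inject:
  assumes "distinct xs" "distinct ys" "set xs = set ys" "code xs = code ys"
  shows "xs = ys"
  using assms
proof (induction xs arbitrary: ys)
  case (Cons x xs)
  then obtain y ys' where ys: "ys = y # ys'"
    by (cases ys) auto
  let ?A = "set (x # xs)"
  have "card {z \<in> ?A. z < x} = card {z \<in> ?A. z < y}"
  proof -
    have "card {z \<in> ?A. z < x} = length (filter (\<lambda>z. z < x) xs)"
      using hd_code[OF Cons.prems(1)] by (rule sym)
    also have "\<dots> = length (filter (\<lambda>z. z < y) ys')"
      using Cons.prems(4) by (simp add: ys)
    also have "\<dots> = card {z \<in> ?A. z < y}"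
      unfolding Cons.prems(3) unfolding ys by (rule hd_code) (use Cons.prems(2) ys in simp)
    finally show ?thesis .
  qed
  moreover have "x \<in> ?A" "y \<in> ?A"
    using Cons.prems(3) ys by auto
  ultimately have "x = y"
    by (rule inj_onD[OF bij_betw_imp_inj_on[OF bij_betw_rank[OF finite_set]]])
  moreover have "set xs = set ys'"
    using Cons.prems unfolding ys \<open>x = y\<close> by (auto simp: insert_eq_iff)
  ultimately show ?case
    using Cons.IH[of ys'] Cons.prems ys by simp
qed simp

text \<open>At step \<open>i\<close> there are \<open>length cs - i\<close> values left, so the
  bound says that one of them has rank \<open>cs ! i\<close>; it is chosen and removed.\<close>

lemma code_exists:
  assumes "finite A" "length cs = card A" "\<And>i. i < length cs \<Longrightarrow> cs ! i + i < length cs"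
  shows "\<exists>xs. distinct xs \<and> set xs = A \<and> code xs = cs"
  using assms
proof (induction cs arbitrary: A)
  case (Cons c cs)
  have "c < card A"
    using Cons.prems(2) Cons.prems(3)[of 0] by simp
  then have "c \<in> (\<lambda>x. card {z \<in> A. z < x}) ` A"
    using bij_betw_imp_surj_on[OF bij_betw_rank[OF Cons.prems(1)]] by simp
  then obtain a where a: "a \<in> A" "c = card {z \<in> A. z < a}"
    by blast
  have "\<exists>xs. distinct xs \<and> set xs = A - {a} \<and> code xs = cs"
  proof (rule Cons.IH)
    show "cs ! i + i < length cs" if "i < length cs" for i
      using Cons.prems(3)[of "Suc i"] that by simp
  qed (use Cons.prems a in auto)
  then obtain xs where xs: "distinct xs" "set xs = A - {a}" "code xs = cs"
    by blast
  then have A: "distinct (a # xs)" "set (a # xs) = A"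
    using a by auto
  moreover have "code (a # xs) = c # cs"
    using hd_code[OF A(1), unfolded A(2)] a(2) xs(3) by simp
  ultimately show ?case
    by blast
qed simp

section \<open>Avoidance and indecomposability read off the code\<close>

text \<open>Without 132, every entry counted by the code at \<open>j\<close> is also counted at an
  earlier \<open>i\<close>. Conversely, an occurrence of 132 under a decreasing code would yield
  another one whose first position is closer to the second, an infinite descent.\<close>

lemma avoids_132_iff_code:
  assumes "distinct \<pi>"
  shows "avoids \<pi> [1,3,2] \<longleftrightarrow> sorted_wrt (\<ge>) (code \<pi>)"
proof
  assume av: "avoids \<pi> [1,3,2]"
  have "code \<pi> ! j \<le> code \<pi> ! i" if ij: "i < j" "j < length \<pi>" for i j
  proof -
    have "\<pi> ! l < \<pi> ! i" if l: "j < l" "l < length \<pi>" "\<pi> ! l < \<pi> ! j" for l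
    proof (rule ccontr)
      assume "\<not> \<pi> ! l < \<pi> ! i"
      moreover have "\<pi> ! l \<noteq> \<pi> ! i"
        using assms ij l by (simp add: nth_eq_iff_index_eq)
      ultimately show False
        using av ij l unfolding avoids_132_iff by (meson linorder_neqE_nat)
    qed
    then have "{l. j < l \<and> l < length \<pi> \<and> \<pi> ! l < \<pi> ! j} \<subseteq> {l. i < l \<and> l < length \<pi> \<and> \<pi> ! l < \<pi> ! i}"
      using ij by auto
    then show ?thesis
      using ij by (simp add: code_nth card_mono)
  qed
  then show "sorted_wrt (\<ge>) (code \<pi>)"
    by (simp add: sorted_wrt_iff_nth_less)
next
  assume sorted: "sorted_wrt (\<ge>) (code \<pi>)"
  have False if "i < j" "j < k" "k < length \<pi>" "\<pi> ! i < \<pi> ! k" "\<pi> ! k < \<pi> ! j" for i j k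
    using that
  proof (induction "j - i" arbitrary: i rule: less_induct)
    case less
    have le: "code \<pi> ! j \<le> code \<pi> ! i"
      using sorted less.prems by (simp add: sorted_wrt_iff_nth_less)
    let ?A = "{l. i < l \<and> l < length \<pi> \<and> \<pi> ! l < \<pi> ! i}"
    let ?B = "{l. j < l \<and> l < length \<pi> \<and> \<pi> ! l < \<pi> ! j}"
    have "\<not> ?A \<subset> ?B"
    proof
      assume "?A \<subset> ?B"
      then have "card ?A < card ?B"
        by (intro psubset_card_mono) auto
      then show False
        using le less.prems by (simp add: code_nth)
    qed
    moreover have "k \<in> ?B" "k \<notin> ?A"
      using less.prems by auto
    ultimately have "\<not> ?A \<subseteq> ?B"
      by blast
    \<comment> \<open>An entry counted at \<open>i\<close> but not at \<open>j\<close> lies at or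
      before \<open>j\<close>: if it came later, it would be below
      \<open>\<pi> ! i < \<pi> ! j\<close> and so counted at \<open>j\<close>. It can replace
      \<open>i\<close> in the occurrence.\<close>
    then obtain l where l: "i < l" "l < length \<pi>" "\<pi> ! l < \<pi> ! i" "l \<le> j"
      using less.prems by force
    then have "l < j"
      using less.prems by (metis le_neq_implies_less less_asym less_trans)
    then have "j - l < j - i"
      using l by linarith
    then show False
      using less.hyps[of l] \<open>l < j\<close> l less.prems by simp
  qed
  then show "avoids \<pi> [1,3,2]"
    unfolding avoids_132_iff by blast
qed

text \<open>Every later entry is either smaller or larger. Thus bounds on
  \<open>code \<pi> ! i + i\<close> become bounds on the number of later larger entries.\<close>

lemma code_add_larger:
  assumes "distinct \<pi>" "i < length \<pi>"
  shows "code \<pi> ! i + card {l. i < l \<and> l < length \<pi> \<and> \<pi> ! i < \<pi> ! l} + i + 1 = length \<pi>"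
proof -
  let ?A = "{l. i < l \<and> l < length \<pi> \<and> \<pi> ! l < \<pi> ! i}"
  let ?B = "{l. i < l \<and> l < length \<pi> \<and> \<pi> ! i < \<pi> ! l}"
  have "\<pi> ! l < \<pi> ! i \<or> \<pi> ! i < \<pi> ! l" if "i < l" "l < length \<pi>" for l
    using assms that nth_eq_iff_index_eq[of \<pi> l i] by auto
  then have "?A \<union> ?B = {l. i < l \<and> l < length \<pi>}"
    by blast
  also have "\<dots> = {i<..<length \<pi>}"
    by auto
  finally have "?A \<union> ?B = {i<..<length \<pi>}" .
  moreover have "card (?A \<union> ?B) = card ?A + card ?B"
    by (intro card_Un_disjoint) auto
  ultimately show ?thesis
    using assms(2) by (simp add: code_nth)
qed

lemma slow_part_iff:
  "slow (part cs) \<longleftrightarrow>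
     (\<forall>i j. i < j \<and> j < length cs \<and> 0 < cs ! j \<longrightarrow> cs ! j + j \<le> Suc (cs ! i + i))"
  by (auto simp: slow_def part_def)

text \<open>By \<open>code_add_larger\<close>, slowness says that \<open>?U i\<close> has at most
  one element more than \<open>?U j\<close> whenever some entry after \<open>j\<close> is smaller
  than \<open>\<pi> ! j\<close>. Two surplus elements of \<open>?U i\<close> supply the 3 and 4 of a
  2341 whose 2 is \<open>\<pi> ! i\<close>.\<close>

lemma avoids_2341_iff_code:
  assumes dist: "distinct \<pi>" and av: "avoids \<pi> [1,3,2]"
  shows "avoids \<pi> [2,3,4,1] \<longleftrightarrow> slow (part (code \<pi>))"
proof -
  let ?U = "\<lambda>i. {l. i < l \<and> l < length \<pi> \<and> \<pi> ! i < \<pi> ! l}"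
  have neq: "\<pi> ! i \<noteq> \<pi> ! j" if "i < j" "j < length \<pi>" for i j
    using dist that by (simp add: nth_eq_iff_index_eq)
  have no132: "\<pi> ! j < \<pi> ! k" if "i < j" "j < k" "k < length \<pi>" "\<pi> ! i < \<pi> ! k" "\<pi> ! i < \<pi> ! j" for i j k
    using av neq[of j k] that unfolding avoids_132_iff by (metis linorder_neqE_nat)
  show ?thesis
  proof
    assume av4: "avoids \<pi> [2,3,4,1]"
    have "code \<pi> ! j + j \<le> Suc (code \<pi> ! i + i)"
      if ij: "i < j" "j < length \<pi>" and nz: "0 < code \<pi> ! j" for i j
    proof (rule ccontr)
      assume "\<not> ?thesis"
      then have u: "card (?U j) + 2 \<le> card (?U i)"
        using code_add_larger[OF dist, of i] code_add_larger[OF dist, of j] ij by simp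
      let ?W = "?U i \<inter> {..j}"
      \<comment> \<open>After \<open>j\<close>, avoidance of 132 makes everything larger than
        \<open>\<pi> ! i\<close> also larger than \<open>\<pi> ! j\<close>. The surplus of
        \<open>?U i\<close> must therefore sit at positions up to \<open>j\<close>.\<close>
      have "\<pi> ! j < \<pi> ! l" if "j < l" "l < length \<pi>" "\<pi> ! i < \<pi> ! l" for l
        using no132[of i j l] neq[of i j] ij that by (cases "\<pi> ! i < \<pi> ! j") auto
      then have "?U i \<subseteq> ?W \<union> ?U j"
        by force
      then have "card (?U i) \<le> card (?W \<union> ?U j)"
        by (intro card_mono) auto
      also have "\<dots> \<le> card ?W + card (?U j)"
        by (rule card_Un_le)
      finally have "2 \<le> card ?W"
        using u by simp
      then have "\<not> card ?W \<le> Suc 0"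
        by linarith
      moreover have "finite ?W"
        by simp
      ultimately have "\<exists>a \<in> ?W. \<exists>b \<in> ?W. a \<noteq> b"
        unfolding card_le_Suc0_iff_eq[OF \<open>finite ?W\<close>] by blast
      then obtain a b where "a \<in> ?W" "b \<in> ?W" "a < b"
        by (meson linorder_neqE_nat)
      then have ab: "i < a" "a < b" "b \<le> j" "\<pi> ! i < \<pi> ! a" "\<pi> ! i < \<pi> ! b"
        by auto
      have "\<pi> ! a < \<pi> ! b"
        using no132[of i a b] ab ij by simp
      \<comment> \<open>The 1 of the pattern is \<open>\<pi> ! j\<close> if it is below
        \<open>\<pi> ! i\<close>. Otherwise it is an entry counted by the nonzero code at
        \<open>j\<close>, which avoidance of 132 pushes below \<open>\<pi> ! i\<close>.\<close>
      moreover have "\<exists>l. b < l \<and> l < length \<pi> \<and> \<pi> ! l < \<pi> ! i"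
      proof (cases "\<pi> ! i < \<pi> ! j")
        case False
        then have "\<pi> ! j < \<pi> ! i" "b \<noteq> j"
          using neq[of i j] ij ab by auto
        then show ?thesis
          using ab ij by (intro exI[of _ j]) auto
      next
        case True
        have "{l. j < l \<and> l < length \<pi> \<and> \<pi> ! l < \<pi> ! j} \<noteq> {}"
          using nz ij by (auto simp: code_nth card_gt_0_iff)
        then obtain z where z: "j < z" "z < length \<pi>" "\<pi> ! z < \<pi> ! j"
          by blast
        then have "\<pi> ! z < \<pi> ! i"
          using no132[of i j z] neq[of i z] True ij by fastforce
        then show ?thesis
          using z ab by (intro exI[of _ z]) auto
      qed
      ultimately show False
        using av4 ab unfolding avoids_2341_iff by blast
    qed
    then show "slow (part (code \<pi>))"
      by (simp add: slow_part_iff)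
  next
    assume slow: "slow (part (code \<pi>))"
    show "avoids \<pi> [2,3,4,1]"
      unfolding avoids_2341_iff
    proof clarify
      fix i a b z
      assume *: "i < a" "a < b" "b < z" "z < length \<pi>" "\<pi> ! z < \<pi> ! i" "\<pi> ! i < \<pi> ! a" "\<pi> ! a < \<pi> ! b"
      have "z \<in> {l. b < l \<and> l < length \<pi> \<and> \<pi> ! l < \<pi> ! b}"
        using * by simp
      then have "0 < code \<pi> ! b"
        using * by (subst code_nth) (auto simp: card_gt_0_iff)
      then have "code \<pi> ! b + b \<le> Suc (code \<pi> ! i + i)"
        using slow * by (simp add: slow_part_iff)
      then have "card (?U i) \<le> Suc (card (?U b))"
        using code_add_larger[OF dist, of i] code_add_larger[OF dist, of b] * by simp
      \<comment> \<open>The 3 and the 4 of the occurrence belong to \<open>?U i\<close> but not to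
        \<open>?U b\<close>, so the two sizes differ by at least 2.\<close>
      moreover have "{a, b} \<union> ?U b \<subseteq> ?U i"
        using * by auto
      then have "card ({a, b} \<union> ?U b) \<le> card (?U i)"
        by (intro card_mono) auto
      moreover have "card ({a, b} \<union> ?U b) = 2 + card (?U b)"
        using * by (subst card_Un_disjoint) auto
      ultimately show False
        by simp
    qed
  qed
qed

lemma prefix_closed_suffix:
  assumes "is_perm \<pi>" "p \<le> length \<pi>" "\<And>i. i < p \<Longrightarrow> \<pi> ! i \<le> p" "p \<le> j" "j < length \<pi>"
  shows "p < \<pi> ! j"
proof -
  obtain \<tau> where \<tau>: "is_perm \<tau>" "length \<tau> = length \<pi> - p" "\<pi> = direct_sum (take p \<pi>) \<tau>"
    using prefix_closed_split[OF assms(1-3)] by blast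
  then have "\<pi> ! j = p + \<tau> ! (j - p)"
    using assms(2,4,5) by (metis direct_sum_nth length_direct_sum length_take min.absorb2 not_le)
  then show ?thesis
    using is_perm_nth(1)[OF \<tau>(1), of "j - p"] \<tau>(2) assms(4,5) by (simp add: Suc_le_eq)
qed

text \<open>By \<open>code_add_larger\<close>, the equation says that nothing after \<open>i\<close>
  exceeds \<open>\<pi> ! i\<close>, and the nonzero code says that \<open>i\<close> is not the last
  position. In an indecomposable permutation of length at least 2 the position of the maximum
  qualifies, since a maximum at the end could be split off.\<close>

lemma indecomposable_iff_code:
  assumes perm: "is_perm \<pi>" and av: "avoids \<pi> [1,3,2]"
  shows "indecomposable \<pi> \<longleftrightarrow> length \<pi> = 1 \<or>
     (\<exists>i < length \<pi>. 0 < code \<pi> ! i \<and> code \<pi> ! i + i + 1 = length \<pi>)"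
    (is "_ \<longleftrightarrow> _ \<or> ?E")
proof -
  have dist: "distinct \<pi>"
    using perm by (simp add: is_perm_iff)
  show ?thesis
  proof
    assume ind: "indecomposable \<pi>"
    show "length \<pi> = 1 \<or> ?E"
    proof (rule disjCI)
      assume nE: "\<not> ?E"
      show "length \<pi> = 1"
      proof (rule ccontr)
        assume "length \<pi> \<noteq> 1"
        then have len: "2 \<le> length \<pi>"
          using ind by (cases \<pi> rule: remdups_adj.cases) (auto simp: indecomposable_def)
        have "length \<pi> \<in> set \<pi>"
          using perm len by (simp add: is_perm_iff)
        then obtain i where i: "i < length \<pi>" "\<pi> ! i = length \<pi>"
          by (metis in_set_conv_nth)
        have "\<not> \<pi> ! i < \<pi> ! l" if "l < length \<pi>" for l
          using is_perm_nth(2)[OF perm that] i(2) by linarith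
        then have empty: "{l. i < l \<and> l < length \<pi> \<and> \<pi> ! i < \<pi> ! l} = {}"
          by blast
        have "code \<pi> ! i + i + 1 = length \<pi>"
          using code_add_larger[OF dist i(1)] unfolding empty card.empty by linarith
        moreover from this nE i(1) have "\<not> 0 < code \<pi> ! i"
          by metis
        ultimately have "i = length \<pi> - 1"
          by linarith
        have "0 < length \<pi> - 1" "length \<pi> - 1 < length \<pi>"
          using len by linarith+
        then obtain l where l: "l < length \<pi> - 1" "length \<pi> - 1 < \<pi> ! l"
          using ind unfolding indecomposable_iff by blast
        then have "l < length \<pi>"
          by linarith
        moreover from this have "\<pi> ! l = \<pi> ! i"
          using is_perm_nth(2)[OF perm, of l] l i by linarith
        ultimately show False
          using is_perm_nth_eq_iff[OF perm, of l i] l \<open>i = length \<pi> - 1\<close> i by simp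
      qed
    qed
  next
    assume "length \<pi> = 1 \<or> ?E"
    then show "indecomposable \<pi>"
    proof
      assume "length \<pi> = 1"
      then show ?thesis
        using perm by (auto simp: indecomposable_iff)
    next
      assume ?E
      then obtain i where i: "i < length \<pi>" "0 < code \<pi> ! i" "code \<pi> ! i + i + 1 = length \<pi>"
        by blast
      let ?n = "length \<pi> - 1"
      have n: "i < ?n"
        using i by simp
      have "card {l. i < l \<and> l < length \<pi> \<and> \<pi> ! i < \<pi> ! l} = 0"
        using code_add_larger[OF dist i(1)] i(3) by linarith
      moreover have "finite {l. i < l \<and> l < length \<pi> \<and> \<pi> ! i < \<pi> ! l}"
        by simp
      ultimately have "{l. i < l \<and> l < length \<pi> \<and> \<pi> ! i < \<pi> ! l} = {}"
        by (simp only: card_0_eq)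
      moreover have lt: "?n < length \<pi>"
        using i(1) by linarith
      ultimately have "\<not> \<pi> ! i < \<pi> ! ?n"
        using n by blast
      then have less: "\<pi> ! ?n < \<pi> ! i"
        using n is_perm_nth_eq_iff[OF perm i(1) lt] by linarith
      show ?thesis
        unfolding indecomposable_iff
      proof (intro conjI allI impI, rule perm)
        show "\<pi> \<noteq> []"
          using i by auto
        fix p assume p: "0 < p \<and> p < length \<pi>"
        show "\<exists>i<p. p < \<pi> ! i"
        proof (rule ccontr)
          assume "\<not> ?thesis"
          then have closed: "\<And>i. i < p \<Longrightarrow> \<pi> ! i \<le> p"
            by (meson not_less)
          have "p \<le> length \<pi>" "p \<le> ?n"
            using p by linarith+
          then have last: "p < \<pi> ! ?n"
            using prefix_closed_suffix[OF perm _ closed] lt by blast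
          show False
          proof (cases "i < p")
            case True
            then show ?thesis
              using closed[of i] last less by simp
          next
            \<comment> \<open>A cut \<open>p \<le> i\<close> makes \<open>\<pi> ! 0\<close> smaller
              than the last entry, so positions 0, \<open>i\<close> and the last one form a
              132.\<close>
            case False
            then have "0 < i" "\<pi> ! 0 < \<pi> ! ?n"
              using p closed[of 0] last by simp_all
            then show ?thesis
              using av less n unfolding avoids_132_iff
              by (metis Suc_diff_1 i(1) le_less_trans lessI zero_le)
          qed
        qed
      qed
    qed
  qed
qed

section \<open>The bijection between indecomposable permutations and sand piles\<close>

text \<open>In a decreasing code all zeros stand at the end, so the filter only trims the
  padding.\<close>

lemma part_filter:
  assumes "sorted_wrt (\<ge>) (cs :: nat list)"
  shows "part (filter (\<lambda>c. 0 < c) cs) i = part cs i"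
  using assms
proof (induction cs arbitrary: i)
  case (Cons c cs)
  have part_Cons: "part (x # xs) i = (case i of 0 \<Rightarrow> x | Suc i \<Rightarrow> part xs i)" for x xs i
    by (auto simp: part_def split: nat.split)
  show ?case
  proof (cases "c = 0")
    case False
    then show ?thesis
      using Cons by (simp add: part_Cons split: nat.split)
  next
    case True
    then have "\<forall>x \<in> set (c # cs). x = 0"
      using Cons.prems by auto
    then have "filter (\<lambda>c. 0 < c) (c # cs) = []" "part (c # cs) i = 0"
      by (simp_all add: filter_empty_conv, metis nth_mem part_def)
    then show ?thesis
      by (simp add: part_def)
  qed
qed simp

lemma sum_list_filter_pos: "sum_list (filter (\<lambda>c. 0 < c) cs) = (sum_list cs :: nat)"
  by (induction cs) auto

lemma filter_pos_eqI:
  assumes "sorted_wrt (\<ge>) cs" "\<forall>x \<in> set xs. 0 < x" "\<And>i. part cs i = part xs i"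
  shows "filter (\<lambda>c. 0 < c) cs = xs"
  by (rule part_inject) (use assms part_filter[OF assms(1)] in auto)

definition indec_132 :: "nat \<Rightarrow> nat list set" where
  "indec_132 k = {\<pi>. indecomposable \<pi> \<and> avoids \<pi> [1,3,2] \<and> avoids \<pi> [2,3,4,1] \<and>
     card (inversions \<pi>) = k}"

lemma indec_132_code:
  assumes "\<pi> \<in> indec_132 k"
  shows "is_perm \<pi>" "distinct \<pi>" "sorted_wrt (\<ge>) (code \<pi>)" "slow (part (code \<pi>))"
    "sum_list (code \<pi>) = k"
    "length \<pi> = 1 \<or> (\<exists>i < length \<pi>. 0 < code \<pi> ! i \<and> code \<pi> ! i + i + 1 = length \<pi>)"
proof -
  have *: "indecomposable \<pi>" "avoids \<pi> [1,3,2]" "avoids \<pi> [2,3,4,1]" "card (inversions \<pi>) = k"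
    using assms by (simp_all add: indec_132_def)
  show perm: "is_perm \<pi>"
    using *(1) by (simp add: indecomposable_def)
  then show dist: "distinct \<pi>"
    by (simp add: is_perm_iff)
  show "sorted_wrt (\<ge>) (code \<pi>)"
    using avoids_132_iff_code[OF dist] *(2) by simp
  show "slow (part (code \<pi>))"
    using avoids_2341_iff_code[OF dist *(2)] *(3) by simp
  show "sum_list (code \<pi>) = k"
    using *(4) by (simp add: sum_list_code)
  show "length \<pi> = 1 \<or> (\<exists>i < length \<pi>. 0 < code \<pi> ! i \<and> code \<pi> ! i + i + 1 = length \<pi>)"
    using indecomposable_iff_code[OF perm *(2)] *(1) by simp
qed

text \<open>A position with \<open>code \<pi> ! i + i + 1 = length \<pi>\<close> and nonzero code
  has the same code entry in \<open>\<sigma>\<close>, where \<open>code_add_larger\<close> bounds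
  the same sum by \<open>length \<sigma>\<close>. By symmetry the nonzero entries fix the
  length.\<close>

lemma indec_132_length_le:
  assumes \<pi>: "\<pi> \<in> indec_132 k" and \<sigma>: "\<sigma> \<in> indec_132 k'"
    and eq: "\<And>i. part (code \<pi>) i = part (code \<sigma>) i"
  shows "length \<pi> \<le> length \<sigma>"
  using indec_132_code(6)[OF \<pi>]
proof
  assume "length \<pi> = 1"
  then show ?thesis
    using \<sigma> by (cases \<sigma>) (auto simp: indec_132_def indecomposable_def)
next
  assume "\<exists>i < length \<pi>. 0 < code \<pi> ! i \<and> code \<pi> ! i + i + 1 = length \<pi>"
  then obtain i where i: "0 < part (code \<pi>) i" "part (code \<pi>) i + i + 1 = length \<pi>"
    by (auto simp: part_def)
  then have "i < length \<sigma>"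
    using eq[of i] by (auto simp: part_def split: if_splits)
  moreover from this have "part (code \<pi>) i = code \<sigma> ! i"
    unfolding eq by (simp add: part_def)
  ultimately show ?thesis
    using code_add_larger[OF indec_132_code(2)[OF \<sigma>], of i] i(2) by linarith
qed

lemma inj_on_filter_code: "inj_on (\<lambda>\<pi>. filter (\<lambda>c. 0 < c) (code \<pi>)) (indec_132 k)"
proof (rule inj_onI)
  fix \<pi> \<sigma>
  assume \<pi>: "\<pi> \<in> indec_132 k" and \<sigma>: "\<sigma> \<in> indec_132 k"
    and eq: "filter (\<lambda>c. 0 < c) (code \<pi>) = filter (\<lambda>c. 0 < c) (code \<sigma>)"
  have part: "part (code \<pi>) i = part (code \<sigma>) i" for i
    using part_filter[OF indec_132_code(3)[OF \<pi>]] part_filter[OF indec_132_code(3)[OF \<sigma>]] eq by metis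
  have len: "length \<pi> = length \<sigma>"
    using indec_132_length_le[OF \<pi> \<sigma>] indec_132_length_le[OF \<sigma> \<pi>] part by (metis le_antisym)
  have "code \<pi> = code \<sigma>"
  proof (rule nth_equalityI)
    show "code \<pi> ! i = code \<sigma> ! i" if "i < length (code \<pi>)" for i
      using part[of i] that len by (simp add: part_def)
  qed (simp add: len)
  then show "\<pi> = \<sigma>"
    using code_inject indec_132_code(1,2)[OF \<pi>] indec_132_code(1,2)[OF \<sigma>] len
    by (metis is_perm_iff)
qed

text \<open>The partition is padded with zeros to a code of length \<open>Suc m\<close>. The
  position where \<open>xs ! i + i\<close> reaches the maximum \<open>m\<close> then witnesses
  indecomposability.\<close>

lemma sand_piles_code:
  assumes xs: "xs \<in> sand_piles k"
  obtains \<pi> where "\<pi> \<in> indec_132 k" "filter (\<lambda>c. 0 < c) (code \<pi>) = xs"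
proof -
  have pos: "\<forall>x \<in> set xs. 0 < x" and sum: "sum_list xs = k" and slow: "slow (part xs)"
    using xs by (simp_all add: sand_piles_iff_slow)
  \<comment> \<open>For nonempty \<open>xs\<close>, \<open>Suc m\<close> is the least length of a
    code with these entries. The inserted 0 handles the empty partition, which corresponds to the
    permutation of length 1.\<close>
  define m where "m = Max (insert 0 ((\<lambda>i. xs ! i + i) ` {..<length xs}))"
  have fin: "finite (insert 0 ((\<lambda>i. xs ! i + i) ` {..<length xs}))"
    by simp
  have m_ge: "xs ! i + i \<le> m" if "i < length xs" for i
    unfolding m_def using that by (intro Max_ge[OF fin]) auto
  have m_cases: "m = 0 \<or> (\<exists>i < length xs. xs ! i + i = m)"
    using Max_in[OF fin] unfolding m_def[symmetric] by auto
  have pos_nth: "0 < xs ! i" if "i < length xs" for i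
    using pos that by simp
  have len: "length xs \<le> m"
  proof (cases "xs = []")
    case False
    then show ?thesis
      using m_ge[of "length xs - 1"] pos_nth[of "length xs - 1"] by (cases xs) auto
  qed simp
  define cs where "cs = xs @ replicate (Suc m - length xs) 0"
  have lencs: "length cs = Suc m"
    using len by (simp add: cs_def)
  have part_cs: "part cs i = part xs i" for i
    by (auto simp: cs_def part_def nth_append)
  have "\<exists>\<pi>. distinct \<pi> \<and> set \<pi> = {1..Suc m} \<and> code \<pi> = cs"
  proof (rule code_exists)
    fix i assume "i < length cs"
    then show "cs ! i + i < length cs"
      using m_ge[of i] unfolding lencs by (auto simp: cs_def nth_append)
  qed (simp_all add: lencs)
  then obtain \<pi> where \<pi>: "distinct \<pi>" "set \<pi> = {1..Suc m}" "code \<pi> = cs"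
    by blast
  have len\<pi>: "length \<pi> = Suc m"
    using \<pi>(1,2) by (metis card_atLeastAtMost diff_Suc_1 distinct_card)
  then have perm: "is_perm \<pi>"
    using \<pi> by (simp add: is_perm_iff)
  have sorted: "sorted_wrt (\<ge>) cs"
  proof -
    have "sorted_wrt (\<ge>) xs"
      using sand_piles_is_partition[OF xs] by (simp add: is_partition_def)
    moreover have "sorted_wrt (\<ge>) (replicate r (0::nat))" for r
      by (simp add: sorted_wrt_iff_nth_less)
    ultimately show ?thesis
      by (simp add: cs_def sorted_wrt_append)
  qed
  have av3: "avoids \<pi> [1,3,2]"
    using avoids_132_iff_code[OF \<pi>(1)] sorted \<pi>(3) by simp
  have "part cs = part xs"
    using part_cs by blast
  then have av4: "avoids \<pi> [2,3,4,1]"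
    using avoids_2341_iff_code[OF \<pi>(1) av3] slow \<pi>(3) by simp
  have "indecomposable \<pi>"
    unfolding indecomposable_iff_code[OF perm av3] len\<pi> \<pi>(3)
    using m_cases
  proof
    assume "\<exists>i < length xs. xs ! i + i = m"
    then obtain i where i: "i < length xs" "xs ! i + i = m"
      by blast
    then have "cs ! i = xs ! i"
      by (simp add: cs_def nth_append)
    then show "Suc m = 1 \<or> (\<exists>i<Suc m. 0 < cs ! i \<and> cs ! i + i + 1 = Suc m)"
      using i pos_nth[OF i(1)] by (intro disjI2 exI[of _ i]) simp
  qed simp
  moreover have "card (inversions \<pi>) = k"
    using sum \<pi>(3) by (simp add: sum_list_code[symmetric] cs_def)
  ultimately have "\<pi> \<in> indec_132 k"
    using av3 av4 by (simp add: indec_132_def)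
  then show ?thesis
    using that filter_pos_eqI[OF sorted pos part_cs] \<pi>(3) by simp
qed

lemma bij_betw_indec_132_sand_piles:
  "bij_betw (\<lambda>\<pi>. filter (\<lambda>c. 0 < c) (code \<pi>)) (indec_132 k) (sand_piles k)"
  unfolding bij_betw_def
proof (intro conjI inj_on_filter_code subset_antisym subsetI)
  fix xs assume "xs \<in> (\<lambda>\<pi>. filter (\<lambda>c. 0 < c) (code \<pi>)) ` indec_132 k"
  then obtain \<pi> where \<pi>: "\<pi> \<in> indec_132 k" and xs: "xs = filter (\<lambda>c. 0 < c) (code \<pi>)"
    by blast
  have "part xs = part (code \<pi>)"
    unfolding xs using part_filter[OF indec_132_code(3)[OF \<pi>]] by blast
  then show "xs \<in> sand_piles k"
    using indec_132_code(4,5)[OF \<pi>] by (simp add: sand_piles_iff_slow xs sum_list_filter_pos)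
next
  fix xs assume "xs \<in> sand_piles k"
  then show "xs \<in> (\<lambda>\<pi>. filter (\<lambda>c. 0 < c) (code \<pi>)) ` indec_132 k"
    using sand_piles_code by (metis (no_types, lifting) rev_image_eqI)
qed

subsection \<open>The decomposition of long permutations\<close>

text \<open>Reverse-complement-inverse, i.e. reflection of the permutation diagram in the antidiagonal.\<close>

definition flip :: "nat list \<Rightarrow> nat list" where
  "flip \<pi> = map (\<lambda>i. length \<pi> - (THE j. j < length \<pi> \<and> \<pi> ! j = length \<pi> - i)) [0..<length \<pi>]"

lemma length_flip [simp]: "length (flip \<pi>) = length \<pi>"
  by (simp add: flip_def)

lemma is_perm_position:
  assumes "is_perm \<pi>" "1 \<le> v" "v \<le> length \<pi>"
  shows "\<exists>!j. j < length \<pi> \<and> \<pi> ! j = v"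
proof -
  have "v \<in> set \<pi>"
    using assms by (simp add: is_perm_iff)
  then show ?thesis
    using is_perm_nth_eq_iff[OF assms(1)] by (metis in_set_conv_nth)
qed

lemma flip_nth_position:
  assumes "is_perm \<pi>" "i < length \<pi>"
  obtains j where "j < length \<pi>" "\<pi> ! j = length \<pi> - i" "flip \<pi> ! i = length \<pi> - j"
proof -
  have ex1: "\<exists>!j. j < length \<pi> \<and> \<pi> ! j = length \<pi> - i"
    using assms by (intro is_perm_position) simp_all
  let ?j = "THE j. j < length \<pi> \<and> \<pi> ! j = length \<pi> - i"
  have "?j < length \<pi> \<and> \<pi> ! ?j = length \<pi> - i"
    by (rule theI'[OF ex1])
  moreover have "flip \<pi> ! i = length \<pi> - ?j"
    using assms(2) by (simp add: flip_def)
  ultimately show ?thesis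
    using that by blast
qed

text \<open>The position in \<open>\<pi>\<close> of the point that is reflected to index
  \<open>i\<close>; for permutations and valid indices it carries the value
  \<open>length \<pi> - i\<close>, see \<open>flip_pos\<close>.\<close>

definition flip_pos :: "nat list \<Rightarrow> nat \<Rightarrow> nat" where
  "flip_pos \<pi> i = length \<pi> - flip \<pi> ! i"

lemma flip_pos:
  assumes "is_perm \<pi>" "i < length \<pi>"
  shows "flip_pos \<pi> i < length \<pi>" "\<pi> ! flip_pos \<pi> i = length \<pi> - i"
    "flip \<pi> ! i = length \<pi> - flip_pos \<pi> i"
proof -
  obtain j where j: "j < length \<pi>" "\<pi> ! j = length \<pi> - i" "flip \<pi> ! i = length \<pi> - j"
    by (rule flip_nth_position[OF assms])
  then have "flip_pos \<pi> i = j"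
    by (simp add: flip_pos_def)
  with j show "flip_pos \<pi> i < length \<pi>" "\<pi> ! flip_pos \<pi> i = length \<pi> - i"
    "flip \<pi> ! i = length \<pi> - flip_pos \<pi> i"
    by simp_all
qed

text \<open>The reflection exchanges the position order with the reversed value order. Occurrences
  of patterns and inversions are carried over by these two equivalences.\<close>

lemma flip_pos_less_iff:
  assumes "is_perm \<pi>" "i < length \<pi>" "j < length \<pi>"
  shows "flip_pos \<pi> i < flip_pos \<pi> j \<longleftrightarrow> flip \<pi> ! j < flip \<pi> ! i"
    "\<pi> ! flip_pos \<pi> i < \<pi> ! flip_pos \<pi> j \<longleftrightarrow> j < i"
  using flip_pos[OF assms(1,2)] flip_pos[OF assms(1,3)] assms(2,3) by auto

lemma is_perm_flip:
  assumes "is_perm \<pi>"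
  shows "is_perm (flip \<pi>)"
proof -
  have "distinct (flip \<pi>)"
    unfolding distinct_conv_nth
  proof (intro allI impI)
    fix i j assume ij: "i < length (flip \<pi>)" "j < length (flip \<pi>)" "i \<noteq> j"
    then have "\<pi> ! flip_pos \<pi> i \<noteq> \<pi> ! flip_pos \<pi> j"
      using flip_pos(2)[OF assms, of i] flip_pos(2)[OF assms, of j] by simp
    then show "flip \<pi> ! i \<noteq> flip \<pi> ! j"
      unfolding flip_pos_def by metis
  qed
  moreover have "flip \<pi> ! i \<in> {1..length \<pi>}" if "i < length \<pi>" for i
    using flip_pos(1,3)[OF assms that] by simp
  then have "set (flip \<pi>) \<subseteq> {1..length \<pi>}"
    unfolding set_conv_nth by auto
  ultimately show ?thesis
    by (simp add: is_perm_iff card_subset_eq distinct_card)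
qed

lemma flip_flip:
  assumes "is_perm \<pi>"
  shows "flip (flip \<pi>) = \<pi>"
proof (rule nth_equalityI)
  fix i assume "i < length (flip (flip \<pi>))"
  then have i: "i < length \<pi>"
    by simp
  let ?j = "flip_pos (flip \<pi>) i"
  have j: "?j < length \<pi>" "flip \<pi> ! ?j = length \<pi> - i" "flip (flip \<pi>) ! i = length \<pi> - ?j"
    using flip_pos[OF is_perm_flip[OF assms], of i] i by simp_all
  have "flip_pos \<pi> ?j = i"
    unfolding flip_pos_def[of \<pi>] j(2) using i by simp
  then have "\<pi> ! i = length \<pi> - ?j"
    using flip_pos(2)[OF assms j(1)] by metis
  then show "flip (flip \<pi>) ! i = \<pi> ! i"
    using j(3) by metis
qed simp

text \<open>A 213 at \<open>i < j < k\<close> in the flip is a 132 in \<open>\<pi>\<close> at the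
  positions belonging to \<open>k\<close>, \<open>i\<close>, \<open>j\<close>, in this
  order.\<close>

lemma avoids_213_flip:
  assumes perm: "is_perm \<pi>" and av: "avoids \<pi> [1,3,2]"
  shows "avoids (flip \<pi>) [2,1,3]"
  unfolding avoids_213_iff
proof clarify
  fix i j k
  assume *: "i < j" "j < k" "k < length (flip \<pi>)" "flip \<pi> ! j < flip \<pi> ! i" "flip \<pi> ! i < flip \<pi> ! k"
  let ?p = "flip_pos \<pi>"
  have l: "i < length \<pi>" "j < length \<pi>" "k < length \<pi>"
    using * by simp_all
  have "?p k < ?p i" "?p i < ?p j" "?p j < length \<pi>" "\<pi> ! ?p k < \<pi> ! ?p j" "\<pi> ! ?p j < \<pi> ! ?p i"
    using * l flip_pos_less_iff[OF perm] flip_pos(1)[OF perm] by simp_all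
  then show False
    using av unfolding avoids_132_iff by blast
qed

lemma avoids_132_flip:
  assumes perm: "is_perm \<pi>" and av: "avoids \<pi> [2,1,3]"
  shows "avoids (flip \<pi>) [1,3,2]"
  unfolding avoids_132_iff
proof clarify
  fix i j k
  assume *: "i < j" "j < k" "k < length (flip \<pi>)" "flip \<pi> ! i < flip \<pi> ! k" "flip \<pi> ! k < flip \<pi> ! j"
  let ?p = "flip_pos \<pi>"
  have l: "i < length \<pi>" "j < length \<pi>" "k < length \<pi>"
    using * by simp_all
  have "?p j < ?p k" "?p k < ?p i" "?p i < length \<pi>" "\<pi> ! ?p k < \<pi> ! ?p j" "\<pi> ! ?p j < \<pi> ! ?p i"
    using * l flip_pos_less_iff[OF perm] flip_pos(1)[OF perm] by simp_all
  then show False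
    using av unfolding avoids_213_iff by blast
qed

text \<open>The pattern 2341 is symmetric under reflection in the antidiagonal.\<close>

lemma avoids_2341_flip:
  assumes perm: "is_perm \<pi>" and av: "avoids \<pi> [2,3,4,1]"
  shows "avoids (flip \<pi>) [2,3,4,1]"
  unfolding avoids_2341_iff
proof clarify
  fix i j k m
  assume *: "i < j" "j < k" "k < m" "m < length (flip \<pi>)" "flip \<pi> ! m < flip \<pi> ! i"
    "flip \<pi> ! i < flip \<pi> ! j" "flip \<pi> ! j < flip \<pi> ! k"
  let ?p = "flip_pos \<pi>"
  have l: "i < length \<pi>" "j < length \<pi>" "k < length \<pi>" "m < length \<pi>"
    using * by simp_all
  have "?p k < ?p j" "?p j < ?p i" "?p i < ?p m" "?p m < length \<pi>" "\<pi> ! ?p m < \<pi> ! ?p k"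
      "\<pi> ! ?p k < \<pi> ! ?p j" "\<pi> ! ?p j < \<pi> ! ?p i"
    using * l flip_pos_less_iff[OF perm] flip_pos(1)[OF perm] by simp_all
  then show False
    using av unfolding avoids_2341_iff by blast
qed

lemma finite_inversions [simp]: "finite (inversions \<pi>)"
  by (rule finite_subset[of _ "{..<length \<pi>} \<times> {..<length \<pi>}"]) (auto simp: inversions_def)

text \<open>Inversions of the flip map injectively to inversions of \<open>\<pi>\<close>. The
  converse inequality follows by applying this to the flip, since flipping is an involution.\<close>

lemma card_inversions_flip_le:
  assumes perm: "is_perm \<pi>"
  shows "card (inversions (flip \<pi>)) \<le> card (inversions \<pi>)"
proof (rule card_inj_on_le)
  let ?h = "\<lambda>(i, j). (flip_pos \<pi> i, flip_pos \<pi> j)"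
  have inj: "i = j" if "flip_pos \<pi> i = flip_pos \<pi> j" "i < length \<pi>" "j < length \<pi>" for i j
    using flip_pos(2)[OF perm, of i] flip_pos(2)[OF perm, of j] that by simp
  then show "inj_on ?h (inversions (flip \<pi>))"
    by (auto simp: inj_on_def inversions_def)
  show "?h ` inversions (flip \<pi>) \<subseteq> inversions \<pi>"
    using flip_pos_less_iff[OF perm] flip_pos(1)[OF perm] by (auto simp: inversions_def)
qed simp

lemma card_inversions_flip:
  assumes "is_perm \<pi>"
  shows "card (inversions (flip \<pi>)) = card (inversions \<pi>)"
  using card_inversions_flip_le[OF assms] card_inversions_flip_le[OF is_perm_flip[OF assms]]
  by (simp add: flip_flip[OF assms])

text \<open>A cut \<open>c\<close> of the flip is reflected to the cut
  \<open>length \<pi> - c\<close> of \<open>\<pi>\<close>.\<close>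

lemma indecomposable_flip:
  assumes ind: "indecomposable \<pi>"
  shows "indecomposable (flip \<pi>)"
proof (rule ccontr)
  have perm: "is_perm \<pi>"
    using ind by (simp add: indecomposable_def)
  assume "\<not> indecomposable (flip \<pi>)"
  moreover have "flip \<pi> \<noteq> []"
    using ind by (auto simp: indecomposable_def flip_def)
  ultimately obtain c where c: "0 < c" "c < length \<pi>" "\<And>i. i < c \<Longrightarrow> flip \<pi> ! i \<le> c"
    using is_perm_flip[OF perm] unfolding indecomposable_iff length_flip not_less[symmetric] by blast
  have "\<pi> ! j \<le> length \<pi> - c" if j: "j < length \<pi> - c" for j
  proof -
    let ?i = "flip_pos (flip \<pi>) j"
    have i: "?i < length \<pi>" "flip \<pi> ! ?i = length \<pi> - j" "\<pi> ! j = length \<pi> - ?i"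
      using flip_pos[OF is_perm_flip[OF perm], of j] j by (simp_all add: flip_flip[OF perm])
    then have "\<not> ?i < c"
      using c(3)[of ?i] j by auto
    then show ?thesis
      using i(3) by simp
  qed
  moreover have "0 < length \<pi> - c" "length \<pi> - c < length \<pi>"
    using c by simp_all
  ultimately show False
    using ind unfolding indecomposable_iff not_less[symmetric] by blast
qed

definition indec_213 :: "nat \<Rightarrow> nat list set" where
  "indec_213 k = {\<pi>. indecomposable \<pi> \<and> avoids \<pi> [2,1,3] \<and> avoids \<pi> [2,3,4,1] \<and>
     card (inversions \<pi>) = k}"

lemma card_indec_213: "card (indec_213 k) = card (indec_132 k)"
proof -
  have perm: "is_perm \<pi>" if "indecomposable \<pi>" for \<pi>
    using that by (simp add: indecomposable_def)
  have "flip \<pi> \<in> indec_213 k \<and> flip (flip \<pi>) = \<pi>" if "\<pi> \<in> indec_132 k" for \<pi>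
    using that perm[of \<pi>] indecomposable_flip[of \<pi>] avoids_213_flip[of \<pi>] avoids_2341_flip[of \<pi>]
      card_inversions_flip[of \<pi>] flip_flip[of \<pi>]
    unfolding indec_132_def indec_213_def mem_Collect_eq by metis
  moreover have "flip \<pi> \<in> indec_132 k \<and> flip (flip \<pi>) = \<pi>" if "\<pi> \<in> indec_213 k" for \<pi>
    using that perm[of \<pi>] indecomposable_flip[of \<pi>] avoids_132_flip[of \<pi>] avoids_2341_flip[of \<pi>]
      card_inversions_flip[of \<pi>] flip_flip[of \<pi>]
    unfolding indec_132_def indec_213_def mem_Collect_eq by metis
  ultimately have "bij_betw flip (indec_132 k) (indec_213 k)"
    by (intro bij_betw_byWitness[of _ flip]) blast+
  then show ?thesis
    by (rule bij_betw_same_card[symmetric])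
qed

section \<open>Few inversions bound the length of an indecomposable permutation\<close>

text \<open>Each position \<open>l\<close> with \<open>i < l < j\<close> forms an inversion with
  \<open>i\<close> or with \<open>j\<close>, because \<open>\<pi> ! l\<close> cannot lie both above
  \<open>\<pi> ! i\<close> and below \<open>\<pi> ! j\<close>. The pair \<open>(i, j)\<close> itself
  is counted at \<open>l = j\<close>.\<close>

lemma inversion_span:
  assumes "is_perm \<pi>" "(i, j) \<in> inversions \<pi>"
  shows "j - i \<le> card (inversions \<pi>)"
proof -
  let ?h = "\<lambda>l. if \<pi> ! l < \<pi> ! i then (i, l) else (l, j)"
  have "card {i<..j} \<le> card (inversions \<pi>)"
  proof (rule card_inj_on_le)
    show "inj_on ?h {i<..j}"
      by (auto simp: inj_on_def)
    show "?h ` {i<..j} \<subseteq> inversions \<pi>"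
    proof (rule image_subsetI)
      fix l assume l: "l \<in> {i<..j}"
      have ij: "i < j" "j < length \<pi>" "\<pi> ! j < \<pi> ! i"
        using assms(2) by (auto simp: inversions_def)
      show "?h l \<in> inversions \<pi>"
      proof (cases "\<pi> ! l < \<pi> ! i")
        case True
        then show ?thesis
          using l ij by (simp add: inversions_def)
      next
        case False
        then have "l < j"
          using l ij by (metis greaterThanAtMost_iff le_neq_implies_less)
        then show ?thesis
          using False ij by (simp add: inversions_def)
      qed
    qed
  qed simp
  then show ?thesis
    by simp
qed

lemma indecomposable_crossing:
  assumes ind: "indecomposable \<pi>" and p: "0 < p" "p < length \<pi>"
  obtains i j where "(i, j) \<in> inversions \<pi>" "i < p" "p \<le> j"
proof -
  have perm: "is_perm \<pi>"
    using ind by (simp add: indecomposable_def)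
  obtain i where i: "i < p" "p < \<pi> ! i"
    using ind p unfolding indecomposable_iff by blast
  have "\<exists>j. p \<le> j \<and> j < length \<pi> \<and> \<pi> ! j \<le> p"
  proof (rule ccontr)
    assume none: "\<not> ?thesis"
    \<comment> \<open>Pigeonhole: if all \<open>p\<close> small values stood in the first
      \<open>p\<close> positions, they would have to avoid position \<open>i\<close>, which leaves
      only \<open>p - 1\<close> places.\<close>
    have "{1..p} \<subseteq> (!) \<pi> ` ({..<p} - {i})"
    proof
      fix v assume v: "v \<in> {1..p}"
      then have "v \<in> set \<pi>"
        using perm p by (simp add: is_perm_iff)
      then obtain l where "l < length \<pi>" "\<pi> ! l = v"
        by (metis in_set_conv_nth)
      moreover from this have "l < p" "l \<noteq> i"
        using none v i(2) by (auto simp: not_le[symmetric])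
      ultimately show "v \<in> (!) \<pi> ` ({..<p} - {i})"
        by blast
    qed
    then have "card {1..p} \<le> card ({..<p} - {i})"
      by (intro surj_card_le) auto
    then show False
      using i(1) by simp
  qed
  then show ?thesis
    using that[of i] i by (force simp: inversions_def)
qed

text \<open>Every \<open>p\<close> strictly between 0 and the length is crossed by an inversion, and
  each inversion crosses at most \<open>card (inversions \<pi>)\<close> values of \<open>p\<close>
  by \<open>inversion_span\<close>. The bound is crude, but it depends only on the number of
  inversions.\<close>

lemma indecomposable_length:
  assumes ind: "indecomposable \<pi>"
  shows "length \<pi> \<le> card (inversions \<pi>) * card (inversions \<pi>) + 1"
proof -
  let ?I = "inversions \<pi>"
  have perm: "is_perm \<pi>"
    using ind by (simp add: indecomposable_def)
  have "{1..<length \<pi>} \<subseteq> (\<Union>(i, j) \<in> ?I. {i<..j})"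
  proof
    fix p assume "p \<in> {1..<length \<pi>}"
    then have "0 < p" "p < length \<pi>"
      by simp_all
    then obtain i j where "(i, j) \<in> ?I" "i < p" "p \<le> j"
      by (rule indecomposable_crossing[OF ind])
    then show "p \<in> (\<Union>(i, j) \<in> ?I. {i<..j})"
      by force
  qed
  then have "card {1..<length \<pi>} \<le> card (\<Union>(i, j) \<in> ?I. {i<..j})"
    by (intro card_mono) auto
  also have "\<dots> \<le> (\<Sum>z \<in> ?I. card (case z of (i, j) \<Rightarrow> {i<..j}))"
    by (rule card_UN_le) simp
  also have "\<dots> \<le> (\<Sum>z \<in> ?I. card ?I)"
    by (rule sum_mono) (auto dest: inversion_span[OF perm])
  finally show ?thesis
    by simp
qed

section \<open>Inversions and patterns in direct sums\<close>

lemma code_append: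
  "(\<And>x y. x \<in> set xs \<Longrightarrow> y \<in> set ys \<Longrightarrow> x < y) \<Longrightarrow> code (xs @ ys) = code xs @ code ys"
proof (induction xs)
  case (Cons x xs)
  have "filter (\<lambda>y. y < x) ys = []"
    using Cons.prems by (auto simp: filter_empty_conv not_less less_imp_le)
  then show ?case
    using Cons by simp
qed simp

lemma code_map_add: "code (map (\<lambda>v. n + v) xs) = code xs"
  by (induction xs) (simp_all add: filter_map comp_def)

lemma card_inversions_direct_sum:
  assumes "is_perm \<sigma>" "is_perm \<tau>"
  shows "card (inversions (direct_sum \<sigma> \<tau>)) = card (inversions \<sigma>) + card (inversions \<tau>)"
proof -
  have "code (direct_sum \<sigma> \<tau>) = code \<sigma> @ code \<tau>"
    using assms code_append[of \<sigma> "map (\<lambda>v. length \<sigma> + v) \<tau>"]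
    by (auto simp: direct_sum_def code_map_add is_perm_iff)
  then show ?thesis
    by (simp add: sum_list_code[symmetric])
qed

lemma direct_sum_assoc: "direct_sum (direct_sum \<sigma> \<mu>) \<tau> = direct_sum \<sigma> (direct_sum \<mu> \<tau>)"
  by (simp add: direct_sum_def add.assoc)

lemma direct_sum_nth_left: "i < length \<sigma> \<Longrightarrow> direct_sum \<sigma> \<tau> ! i = \<sigma> ! i"
  by (simp add: direct_sum_def nth_append)

lemma direct_sum_nth_right:
  "i < length \<tau> \<Longrightarrow> direct_sum \<sigma> \<tau> ! (length \<sigma> + i) = length \<sigma> + \<tau> ! i"
  by (simp add: direct_sum_def nth_append)

lemma direct_sum_le_iff:
  assumes "is_perm \<sigma>" "is_perm \<tau>" "i < length \<sigma> + length \<tau>"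
  shows "direct_sum \<sigma> \<tau> ! i \<le> length \<sigma> \<longleftrightarrow> i < length \<sigma>"
  using assms(3) is_perm_nth(2)[OF assms(1), of i] is_perm_nth(1)[OF assms(2), of "i - length \<sigma>"]
  by (auto simp: direct_sum_nth Suc_le_eq)

text \<open>The smallest value of an occurrence comes last. If it lies in the second summand, all
  the larger values do too; otherwise all the earlier positions lie in the first.\<close>

lemma avoids_2341_direct_sum:
  assumes perm: "is_perm \<sigma>" "is_perm \<tau>"
  shows "avoids (direct_sum \<sigma> \<tau>) [2,3,4,1] \<longleftrightarrow> avoids \<sigma> [2,3,4,1] \<and> avoids \<tau> [2,3,4,1]"
proof (intro iffI conjI)
  let ?\<pi> = "direct_sum \<sigma> \<tau>" and ?s = "length \<sigma>"
  assume av: "avoids ?\<pi> [2,3,4,1]"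
  show "avoids \<sigma> [2,3,4,1]"
    unfolding avoids_2341_iff
  proof clarify
    fix i j k l
    assume *: "i < j" "j < k" "k < l" "l < length \<sigma>" "\<sigma> ! l < \<sigma> ! i" "\<sigma> ! i < \<sigma> ! j" "\<sigma> ! j < \<sigma> ! k"
    then have "l < length ?\<pi>" "?\<pi> ! l < ?\<pi> ! i" "?\<pi> ! i < ?\<pi> ! j" "?\<pi> ! j < ?\<pi> ! k"
      by (simp_all add: direct_sum_nth_left)
    with * show False
      using av unfolding avoids_2341_iff by blast
  qed
  show "avoids \<tau> [2,3,4,1]"
    unfolding avoids_2341_iff
  proof clarify
    fix i j k l
    assume *: "i < j" "j < k" "k < l" "l < length \<tau>" "\<tau> ! l < \<tau> ! i" "\<tau> ! i < \<tau> ! j" "\<tau> ! j < \<tau> ! k"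
    then have "?s + i < ?s + j" "?s + j < ?s + k" "?s + k < ?s + l" "?s + l < length ?\<pi>"
      "?\<pi> ! (?s + l) < ?\<pi> ! (?s + i)" "?\<pi> ! (?s + i) < ?\<pi> ! (?s + j)" "?\<pi> ! (?s + j) < ?\<pi> ! (?s + k)"
      by (simp_all add: direct_sum_nth_right)
    then show False
      using av unfolding avoids_2341_iff by blast
  qed
next
  let ?\<pi> = "direct_sum \<sigma> \<tau>" and ?s = "length \<sigma>"
  assume av: "avoids \<sigma> [2,3,4,1] \<and> avoids \<tau> [2,3,4,1]"
  show "avoids ?\<pi> [2,3,4,1]"
    unfolding avoids_2341_iff
  proof clarify
    fix i j k l
    assume *: "i < j" "j < k" "k < l" "l < length ?\<pi>" "?\<pi> ! l < ?\<pi> ! i" "?\<pi> ! i < ?\<pi> ! j" "?\<pi> ! j < ?\<pi> ! k"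
    show False
    proof (cases "l < ?s")
      case True
      then have "\<sigma> ! l < \<sigma> ! i" "\<sigma> ! i < \<sigma> ! j" "\<sigma> ! j < \<sigma> ! k"
        using * by (simp_all add: direct_sum_nth_left)
      then show False
        using av * True unfolding avoids_2341_iff by blast
    next
      case False
      have "?s < ?\<pi> ! l"
        using direct_sum_le_iff[OF perm, of l] * False by simp
      then have "?s \<le> i"
        using direct_sum_le_iff[OF perm, of i] * by simp
      then have "i - ?s < j - ?s" "j - ?s < k - ?s" "k - ?s < l - ?s" "l - ?s < length \<tau>"
        "\<tau> ! (l - ?s) < \<tau> ! (i - ?s)" "\<tau> ! (i - ?s) < \<tau> ! (j - ?s)" "\<tau> ! (j - ?s) < \<tau> ! (k - ?s)"
        using * by (simp_all add: direct_sum_nth)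
      then show False
        using av unfolding avoids_2341_iff by blast
    qed
  qed
qed

text \<open>The first entry of \<open>\<tau>\<close> completes a 132 in \<open>\<sigma>\<close>, and
  the first entry of \<open>\<sigma>\<close> completes a 213 in \<open>\<tau>\<close>. Conversely,
  the descent 32 of an occurrence cannot straddle the two summands, so it comes with the 1 in
  \<open>\<sigma>\<close> or with the 4 in \<open>\<tau>\<close>.\<close>

lemma avoids_1324_direct_sum:
  assumes perm: "is_perm \<sigma>" "is_perm \<tau>" and ne: "\<sigma> \<noteq> []" "\<tau> \<noteq> []"
  shows "avoids (direct_sum \<sigma> \<tau>) [1,3,2,4] \<longleftrightarrow> avoids \<sigma> [1,3,2] \<and> avoids \<tau> [2,1,3]"
proof (intro iffI conjI)
  let ?\<pi> = "direct_sum \<sigma> \<tau>" and ?s = "length \<sigma>"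
  assume av: "avoids ?\<pi> [1,3,2,4]"
  show "avoids \<sigma> [1,3,2]"
    unfolding avoids_132_iff
  proof clarify
    fix i j k
    assume *: "i < j" "j < k" "k < length \<sigma>" "\<sigma> ! i < \<sigma> ! k" "\<sigma> ! k < \<sigma> ! j"
    have "?s < length ?\<pi>"
      using ne by simp
    moreover have "\<not> ?\<pi> ! ?s \<le> ?s"
      using direct_sum_le_iff[OF perm, of ?s] ne by simp
    moreover have "?\<pi> ! j \<le> ?s"
      using direct_sum_le_iff[OF perm, of j] * by simp
    moreover have "?\<pi> ! i < ?\<pi> ! k" "?\<pi> ! k < ?\<pi> ! j"
      using * by (simp_all add: direct_sum_nth_left)
    ultimately have "k < ?s" "?s < length ?\<pi>" "?\<pi> ! i < ?\<pi> ! k" "?\<pi> ! k < ?\<pi> ! j" "?\<pi> ! j < ?\<pi> ! ?s"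
      using * by linarith+
    then show False
      using av *(1,2) unfolding avoids_1324_iff by blast
  qed
  show "avoids \<tau> [2,1,3]"
    unfolding avoids_213_iff
  proof clarify
    fix i j k
    assume *: "i < j" "j < k" "k < length \<tau>" "\<tau> ! j < \<tau> ! i" "\<tau> ! i < \<tau> ! k"
    have "?\<pi> ! 0 \<le> ?s"
      using direct_sum_le_iff[OF perm, of 0] ne by simp
    moreover have "\<not> ?\<pi> ! (?s + j) \<le> ?s"
      using direct_sum_le_iff[OF perm, of "?s + j"] * by simp
    ultimately have "?\<pi> ! 0 < ?\<pi> ! (?s + j)"
      by linarith
    moreover have "0 < ?s + i" "?s + i < ?s + j" "?s + j < ?s + k" "?s + k < length ?\<pi>"
      "?\<pi> ! (?s + j) < ?\<pi> ! (?s + i)" "?\<pi> ! (?s + i) < ?\<pi> ! (?s + k)"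
      using * ne by (simp_all add: direct_sum_nth_right)
    ultimately show False
      using av unfolding avoids_1324_iff by blast
  qed
next
  let ?\<pi> = "direct_sum \<sigma> \<tau>" and ?s = "length \<sigma>"
  assume av: "avoids \<sigma> [1,3,2] \<and> avoids \<tau> [2,1,3]"
  show "avoids ?\<pi> [1,3,2,4]"
    unfolding avoids_1324_iff
  proof clarify
    fix i j k l
    assume *: "i < j" "j < k" "k < l" "l < length ?\<pi>" "?\<pi> ! i < ?\<pi> ! k" "?\<pi> ! k < ?\<pi> ! j" "?\<pi> ! j < ?\<pi> ! l"
    show False
    proof (cases "k < ?s")
      case True
      then have "\<sigma> ! i < \<sigma> ! k" "\<sigma> ! k < \<sigma> ! j"
        using * by (simp_all add: direct_sum_nth_left)
      then show False
        using av * True unfolding avoids_132_iff by blast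
    next
      case False
      have "?s < ?\<pi> ! k"
        using direct_sum_le_iff[OF perm, of k] * False by simp
      then have "?s \<le> j"
        using direct_sum_le_iff[OF perm, of j] * by simp
      then have "j - ?s < k - ?s" "k - ?s < l - ?s" "l - ?s < length \<tau>"
        "\<tau> ! (k - ?s) < \<tau> ! (j - ?s)" "\<tau> ! (j - ?s) < \<tau> ! (l - ?s)"
        using * by (simp_all add: direct_sum_nth)
      then show False
        using av unfolding avoids_213_iff by blast
    qed
  qed
qed

text \<open>Any inversion of \<open>\<mu>\<close> is completed to a 213 by the first entry of
  \<open>\<tau>\<close>. Hence the block between the two ends of a long permutation has to be an
  identity.\<close>

lemma avoids_213_direct_sum:
  assumes perm: "is_perm \<mu>" "is_perm \<tau>" and ne: "\<tau> \<noteq> []"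
  shows "avoids (direct_sum \<mu> \<tau>) [2,1,3] \<longleftrightarrow> inversions \<mu> = {} \<and> avoids \<tau> [2,1,3]"
proof (intro iffI conjI)
  let ?\<pi> = "direct_sum \<mu> \<tau>" and ?s = "length \<mu>"
  assume av: "avoids ?\<pi> [2,1,3]"
  show "inversions \<mu> = {}"
  proof (rule ccontr)
    assume "inversions \<mu> \<noteq> {}"
    then obtain i j where *: "i < j" "j < ?s" "\<mu> ! j < \<mu> ! i"
      by (auto simp: inversions_def)
    have "?s < length ?\<pi>"
      using ne by simp
    moreover have "\<not> ?\<pi> ! ?s \<le> ?s"
      using direct_sum_le_iff[OF perm, of ?s] ne by simp
    moreover have "?\<pi> ! i \<le> ?s"
      using direct_sum_le_iff[OF perm, of i] * by simp
    moreover have "?\<pi> ! j < ?\<pi> ! i"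
      using * by (simp add: direct_sum_nth_left)
    ultimately have "?s < length ?\<pi>" "?\<pi> ! j < ?\<pi> ! i" "?\<pi> ! i < ?\<pi> ! ?s"
      by linarith+
    then show False
      using av *(1,2) unfolding avoids_213_iff by blast
  qed
  show "avoids \<tau> [2,1,3]"
    unfolding avoids_213_iff
  proof clarify
    fix i j k
    assume *: "i < j" "j < k" "k < length \<tau>" "\<tau> ! j < \<tau> ! i" "\<tau> ! i < \<tau> ! k"
    then have "?s + i < ?s + j" "?s + j < ?s + k" "?s + k < length ?\<pi>"
      "?\<pi> ! (?s + j) < ?\<pi> ! (?s + i)" "?\<pi> ! (?s + i) < ?\<pi> ! (?s + k)"
      by (simp_all add: direct_sum_nth_right)
    then show False
      using av unfolding avoids_213_iff by blast
  qed
next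
  let ?\<pi> = "direct_sum \<mu> \<tau>" and ?s = "length \<mu>"
  assume av: "inversions \<mu> = {} \<and> avoids \<tau> [2,1,3]"
  show "avoids ?\<pi> [2,1,3]"
    unfolding avoids_213_iff
  proof clarify
    fix i j k
    assume *: "i < j" "j < k" "k < length ?\<pi>" "?\<pi> ! j < ?\<pi> ! i" "?\<pi> ! i < ?\<pi> ! k"
    show False
    proof (cases "j < ?s")
      case True
      then have "(i, j) \<in> inversions \<mu>"
        using * by (simp add: inversions_def direct_sum_nth_left)
      then show False
        using av by simp
    next
      case False
      have "?s < ?\<pi> ! j"
        using direct_sum_le_iff[OF perm, of j] * False by simp
      then have "?s \<le> i"
        using direct_sum_le_iff[OF perm, of i] * by simp
      then have "i - ?s < j - ?s" "j - ?s < k - ?s" "k - ?s < length \<tau>"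
        "\<tau> ! (j - ?s) < \<tau> ! (i - ?s)" "\<tau> ! (i - ?s) < \<tau> ! (k - ?s)"
        using * by (simp_all add: direct_sum_nth)
      then show False
        using av unfolding avoids_213_iff by blast
    qed
  qed
qed

lemma is_perm_upt: "is_perm [1..<Suc n]"
  by (auto simp: is_perm_iff)

lemma inversions_upt: "inversions [1..<Suc n] = {}"
  by (auto simp: inversions_def simp del: upt_Suc)

lemma inversions_empty_iff:
  assumes "is_perm \<mu>" "inversions \<mu> = {}"
  shows "\<mu> = [1..<Suc (length \<mu>)]"
proof (rule sorted_distinct_set_unique)
  show "sorted \<mu>"
    unfolding sorted_iff_nth_mono_less
  proof (intro allI impI)
    fix i j assume "i < j" "j < length \<mu>"
    moreover have "(i, j) \<notin> inversions \<mu>"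
      using assms(2) by simp
    ultimately show "\<mu> ! i \<le> \<mu> ! j"
      by (simp add: inversions_def)
  qed
  show "distinct \<mu>" "set \<mu> = set [1..<Suc (length \<mu>)]"
    using assms(1) unfolding is_perm_iff set_upt atLeastLessThanSuc_atLeastAtMost by blast+
qed (simp_all del: upt_Suc)

lemma avoids_2341_upt: "avoids [1..<Suc n] [2,3,4,1]"
proof -
  have "\<not> [1..<Suc n] ! l < [1..<Suc n] ! i" if "i < l" "l < length [1..<Suc n]" for i l
    using that by (simp del: upt_Suc)
  then show ?thesis
    unfolding avoids_2341_iff by (meson less_trans)
qed

section \<open>Unique decomposition into two indecomposable ends and an identity\<close>

text \<open>The identity in the middle fills up the total length to \<open>n\<close>, provided the
  two ends together have length at most \<open>n\<close>.\<close>

definition glue :: "nat \<Rightarrow> nat list \<Rightarrow> nat list \<Rightarrow> nat list" where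
  "glue n \<sigma> \<tau> = direct_sum \<sigma> (direct_sum [1..<Suc (n - length \<sigma> - length \<tau>)] \<tau>)"

lemma glue_props:
  assumes \<sigma>: "\<sigma> \<in> indec_132 i" and \<tau>: "\<tau> \<in> indec_213 j" and n: "length \<sigma> + length \<tau> \<le> n"
  shows "is_perm (glue n \<sigma> \<tau>)" "length (glue n \<sigma> \<tau>) = n" "card (inversions (glue n \<sigma> \<tau>)) = i + j"
    "avoids (glue n \<sigma> \<tau>) [1,3,2,4]" "avoids (glue n \<sigma> \<tau>) [2,3,4,1]"
proof -
  let ?\<mu> = "[1..<Suc (n - length \<sigma> - length \<tau>)]"
  have perm: "is_perm \<sigma>" "is_perm \<tau>" "is_perm ?\<mu>" and ne: "\<sigma> \<noteq> []" "\<tau> \<noteq> []"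
    using \<sigma> \<tau> is_perm_upt by (simp_all add: indec_132_def indec_213_def indecomposable_def del: upt_Suc)
  have perm': "is_perm (direct_sum ?\<mu> \<tau>)"
    using perm(3,2) by (rule is_perm_direct_sum)
  have ne': "direct_sum ?\<mu> \<tau> \<noteq> []"
    using ne by (simp add: direct_sum_def)
  show "is_perm (glue n \<sigma> \<tau>)"
    unfolding glue_def using perm(1) perm' by (rule is_perm_direct_sum)
  show "length (glue n \<sigma> \<tau>) = n"
    using n by (simp add: glue_def del: upt_Suc)
  show "card (inversions (glue n \<sigma> \<tau>)) = i + j"
    using \<sigma> \<tau> unfolding glue_def card_inversions_direct_sum[OF perm(1) perm']
      card_inversions_direct_sum[OF perm(3) perm(2)] inversions_upt
    by (simp add: indec_132_def indec_213_def)
  show "avoids (glue n \<sigma> \<tau>) [1,3,2,4]"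
    using \<sigma> \<tau> unfolding glue_def avoids_1324_direct_sum[OF perm(1) perm' ne(1) ne']
      avoids_213_direct_sum[OF perm(3) perm(2) ne(2)] inversions_upt
    by (simp add: indec_132_def indec_213_def del: upt_Suc)
  show "avoids (glue n \<sigma> \<tau>) [2,3,4,1]"
    using \<sigma> \<tau> avoids_2341_upt unfolding glue_def avoids_2341_direct_sum[OF perm(1) perm']
      avoids_2341_direct_sum[OF perm(3) perm(2)]
    by (simp add: indec_132_def indec_213_def del: upt_Suc)
qed

text \<open>If \<open>\<sigma>\<close> were shorter than \<open>\<sigma>'\<close>, its length would
  be a cut of \<open>\<sigma>'\<close>. With the roles exchanged, the first indecomposable component
  has a determined length.\<close>

lemma direct_sum_indecomposable_left_length:
  assumes "indecomposable \<sigma>" "indecomposable \<sigma>'" "direct_sum \<sigma> \<rho> = direct_sum \<sigma>' \<rho>'"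
  shows "length \<sigma>' \<le> length \<sigma>"
proof (rule ccontr)
  assume "\<not> length \<sigma>' \<le> length \<sigma>"
  then have less: "length \<sigma> < length \<sigma>'"
    by simp
  have perm: "is_perm \<sigma>" and ne: "\<sigma> \<noteq> []"
    using assms(1) by (simp_all add: indecomposable_def)
  have "\<sigma>' ! i \<le> length \<sigma>" if "i < length \<sigma>" for i
    using is_perm_nth(2)[OF perm that] direct_sum_nth_left[OF that, of \<rho>]
      direct_sum_nth_left[of i \<sigma>' \<rho>'] that less assms(3) by simp
  then show False
    using assms(2) less ne[folded length_greater_0_conv] unfolding indecomposable_iff not_less[symmetric] by blast
qed

text \<open>If \<open>\<tau>\<close> were shorter than \<open>\<tau>'\<close>, the beginning of
  \<open>\<tau>'\<close> would lie inside \<open>\<rho>\<close>, and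
  \<open>length \<tau>' - length \<tau>\<close> would be a cut of \<open>\<tau>'\<close>.\<close>

lemma direct_sum_indecomposable_right_length:
  assumes "indecomposable \<tau>" "indecomposable \<tau>'" "is_perm \<rho>"
    and eq: "direct_sum \<rho> \<tau> = direct_sum \<rho>' \<tau>'"
  shows "length \<tau>' \<le> length \<tau>"
proof (rule ccontr)
  assume "\<not> length \<tau>' \<le> length \<tau>"
  then have less: "length \<tau> < length \<tau>'"
    by simp
  have len: "length \<rho> + length \<tau> = length \<rho>' + length \<tau>'"
    using arg_cong[OF eq, of length] by simp
  let ?c = "length \<tau>' - length \<tau>"
  have "\<tau>' ! i \<le> ?c" if i: "i < ?c" for i
  proof -
    have "length \<rho>' + i < length \<rho>"
      using len i less by linarith
    then have "direct_sum \<rho> \<tau> ! (length \<rho>' + i) \<le> length \<rho>"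
      using is_perm_nth(2)[OF assms(3)] by (simp add: direct_sum_nth_left)
    moreover have "direct_sum \<rho>' \<tau>' ! (length \<rho>' + i) = length \<rho>' + \<tau>' ! i"
      using i by (intro direct_sum_nth_right) simp
    ultimately show ?thesis
      using eq len less by simp
  qed
  moreover have "0 < length \<tau>"
    using assms(1) by (simp add: indecomposable_def)
  then have "0 < ?c" "?c < length \<tau>'"
    using less by linarith+
  ultimately show False
    using assms(2) unfolding indecomposable_iff not_less[symmetric] by blast
qed

lemma direct_sum_inject:
  assumes "length \<sigma> = length \<sigma>'" "direct_sum \<sigma> \<rho> = direct_sum \<sigma>' \<rho>'"
  shows "\<sigma> = \<sigma>'" "\<rho> = \<rho>'"
proof -
  have *: "\<sigma> = \<sigma>' \<and> map (\<lambda>v. length \<sigma> + v) \<rho> = map (\<lambda>v. length \<sigma> + v) \<rho>'"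
    using assms by (simp add: direct_sum_def)
  then show "\<sigma> = \<sigma>'"
    by blast
  show "\<rho> = \<rho>'"
    by (rule map_injective[OF conjunct2[OF *]]) (simp add: inj_def)
qed

lemma glue_inject:
  assumes "indecomposable \<sigma>" "indecomposable \<tau>" "indecomposable \<sigma>'" "indecomposable \<tau>'"
    and eq: "glue n \<sigma> \<tau> = glue n \<sigma>' \<tau>'"
  shows "\<sigma> = \<sigma>'" "\<tau> = \<tau>'"
proof -
  let ?\<mu> = "[1..<Suc (n - length \<sigma> - length \<tau>)]" and ?\<mu>' = "[1..<Suc (n - length \<sigma>' - length \<tau>')]"
  have eq1: "direct_sum \<sigma> (direct_sum ?\<mu> \<tau>) = direct_sum \<sigma>' (direct_sum ?\<mu>' \<tau>')"
    using eq by (simp only: glue_def)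
  then have eq2: "direct_sum (direct_sum \<sigma> ?\<mu>) \<tau> = direct_sum (direct_sum \<sigma>' ?\<mu>') \<tau>'"
    by (simp only: direct_sum_assoc)
  have perm: "is_perm (direct_sum \<sigma> ?\<mu>)" "is_perm (direct_sum \<sigma>' ?\<mu>')"
    using assms is_perm_direct_sum is_perm_upt by (simp_all add: indecomposable_def del: upt_Suc)
  have "length \<sigma> = length \<sigma>'"
    using direct_sum_indecomposable_left_length[OF assms(1,3) eq1]
      direct_sum_indecomposable_left_length[OF assms(3,1) eq1[symmetric]] by simp
  then show "\<sigma> = \<sigma>'"
    using direct_sum_inject(1) eq1 by blast
  have lt: "length \<tau> = length \<tau>'"
    using direct_sum_indecomposable_right_length[OF assms(2,4) perm(1) eq2]
      direct_sum_indecomposable_right_length[OF assms(4,2) perm(2) eq2[symmetric]] by simp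
  then have "length (direct_sum \<sigma> ?\<mu>) = length (direct_sum \<sigma>' ?\<mu>')"
    using arg_cong[OF eq2, of length] by (simp del: upt_Suc)
  then show "\<tau> = \<tau>'"
    using direct_sum_inject(2) eq2 by blast
qed

text \<open>\<open>\<sigma>\<close> is the part before the smallest cut, \<open>\<tau>\<close> the
  part after the largest one, and avoidance of 1324 leaves no inversions in between.\<close>

lemma glue_surj:
  assumes perm: "is_perm \<pi>" and dec: "\<not> indecomposable \<pi>" and ne: "\<pi> \<noteq> []"
    and av: "avoids \<pi> [1,3,2,4]" "avoids \<pi> [2,3,4,1]"
  obtains \<sigma> \<tau> i j where "\<sigma> \<in> indec_132 i" "\<tau> \<in> indec_213 j" "\<pi> = glue (length \<pi>) \<sigma> \<tau>"
    "i + j = card (inversions \<pi>)" "length \<sigma> + length \<tau> \<le> length \<pi>"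
proof -
  define C where "C = {p. 0 < p \<and> p < length \<pi> \<and> (\<forall>i<p. \<pi> ! i \<le> p)}"
  have fin: "finite C"
    by (rule finite_subset[of _ "{..<length \<pi>}"]) (auto simp: C_def)
  have "\<exists>p. 0 < p \<and> p < length \<pi> \<and> (\<forall>i<p. \<not> p < \<pi> ! i)"
    using dec perm ne unfolding indecomposable_iff by blast
  then have "C \<noteq> {}"
    unfolding C_def not_less by blast
  \<comment> \<open>The two cuts may coincide, in which case the middle block is empty.\<close>
  define s q where "s = Min C" and "q = Max C"
  have sC: "s \<in> C" and qC: "q \<in> C" and sq: "s \<le> q"
    unfolding s_def q_def using fin \<open>C \<noteq> {}\<close> by simp_all
  have s_min: "p \<notin> C" if "p < s" for p
    using that Min_le[OF fin, of p] unfolding s_def by (meson not_le)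
  have q_max: "p \<notin> C" if "q < p" for p
    using that Max_ge[OF fin, of p] unfolding q_def by (meson not_le)
  have s: "0 < s" "s < length \<pi>" "\<And>i. i < s \<Longrightarrow> \<pi> ! i \<le> s"
    and q: "0 < q" "q < length \<pi>" "\<And>i. i < q \<Longrightarrow> \<pi> ! i \<le> q"
    using sC qC by (simp_all add: C_def)
  obtain \<tau> where \<tau>: "is_perm (take q \<pi>)" "is_perm \<tau>" "length \<tau> = length \<pi> - q"
    "\<pi> = direct_sum (take q \<pi>) \<tau>"
    by (rule prefix_closed_split[OF perm less_imp_le[OF q(2)] q(3)])
  have "s \<le> length (take q \<pi>)" "\<And>i. i < s \<Longrightarrow> take q \<pi> ! i \<le> s"
    using sq q(2) s(3) by simp_all
  then obtain \<mu> where \<mu>: "is_perm (take s (take q \<pi>))" "is_perm \<mu>"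
    "take q \<pi> = direct_sum (take s (take q \<pi>)) \<mu>"
    using prefix_closed_split[OF \<tau>(1)] by metis
  define \<sigma> where "\<sigma> = take s (take q \<pi>)"
  have len\<sigma>: "length \<sigma> = s" and perm\<sigma>: "is_perm \<sigma>"
    using sq q(2) \<mu>(1) by (simp_all add: \<sigma>_def)
  have "take q \<pi> = direct_sum \<sigma> \<mu>"
    using \<mu>(3) unfolding \<sigma>_def .
  then have "direct_sum (take q \<pi>) \<tau> = direct_sum \<sigma> (direct_sum \<mu> \<tau>)"
    by (simp only: direct_sum_assoc)
  with \<tau>(4) have \<pi>: "\<pi> = direct_sum \<sigma> (direct_sum \<mu> \<tau>)"
    by (rule trans)
  have ne\<sigma>: "\<sigma> \<noteq> []" and ne\<tau>: "\<tau> \<noteq> []"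
    using len\<sigma> s(1) \<tau>(3) q(2) by auto
  have perm\<mu>\<tau>: "is_perm (direct_sum \<mu> \<tau>)" and ne\<mu>\<tau>: "direct_sum \<mu> \<tau> \<noteq> []"
    using is_perm_direct_sum \<mu>(2) \<tau>(2) ne\<tau> by (simp_all add: direct_sum_def)
  have av3: "avoids \<sigma> [1,3,2]" "inversions \<mu> = {}" "avoids \<tau> [2,1,3]"
    using av(1) unfolding \<pi> avoids_1324_direct_sum[OF perm\<sigma> perm\<mu>\<tau> ne\<sigma> ne\<mu>\<tau>]
      avoids_213_direct_sum[OF \<mu>(2) \<tau>(2) ne\<tau>] by blast+
  have av4: "avoids \<sigma> [2,3,4,1]" "avoids \<tau> [2,3,4,1]"
    using av(2) unfolding \<pi> avoids_2341_direct_sum[OF perm\<sigma> perm\<mu>\<tau>]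
      avoids_2341_direct_sum[OF \<mu>(2) \<tau>(2)] by blast+
  have "indecomposable \<sigma>"
    unfolding indecomposable_iff
  proof (intro conjI allI impI perm\<sigma> ne\<sigma>)
    fix p assume p: "0 < p \<and> p < length \<sigma>"
    show "\<exists>i<p. p < \<sigma> ! i"
    proof (rule ccontr)
      assume "\<not> ?thesis"
      then have "\<sigma> ! i \<le> p" if "i < p" for i
        using that by (meson not_less)
      moreover have "\<pi> ! i = \<sigma> ! i" if "i < p" for i
        unfolding \<pi> using that p by (intro direct_sum_nth_left) linarith
      ultimately have "\<pi> ! i \<le> p" if "i < p" for i
        using that by simp
      \<comment> \<open>A cut of the first component is a cut of \<open>\<pi>\<close> below the
        smallest one.\<close>
      then have "p \<in> C"
        using p len\<sigma> s(2) by (simp add: C_def)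
      then show False
        using s_min p len\<sigma> by blast
    qed
  qed
  moreover have "indecomposable \<tau>"
    unfolding indecomposable_iff
  proof (intro conjI allI impI \<tau>(2) ne\<tau>)
    fix p assume p: "0 < p \<and> p < length \<tau>"
    have lenq: "length (take q \<pi>) = q"
      using q(2) by simp
    show "\<exists>i<p. p < \<tau> ! i"
    proof (rule ccontr)
      assume n: "\<not> ?thesis"
      have "\<pi> ! i \<le> q + p" if "i < q + p" for i
      proof (cases "i < q")
        case True
        then show ?thesis
          using q(3)[of i] by simp
      next
        case False
        then have "i = length (take q \<pi>) + (i - q)" "i - q < p"
          using lenq that by simp_all
        moreover have "direct_sum (take q \<pi>) \<tau> ! (length (take q \<pi>) + (i - q)) =
            length (take q \<pi>) + \<tau> ! (i - q)"
          using \<open>i - q < p\<close> p by (intro direct_sum_nth_right) linarith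
        ultimately have "\<pi> ! i = q + \<tau> ! (i - q)"
          using \<tau>(4) lenq by metis
        moreover have "\<tau> ! (i - q) \<le> p"
          using n \<open>i - q < p\<close> by (meson not_less)
        ultimately show ?thesis
          by linarith
      qed
      moreover have "q + p < length \<pi>"
        using p \<tau>(3) by linarith
      \<comment> \<open>A cut of the last component, shifted by \<open>q\<close>, is a cut of
        \<open>\<pi>\<close> beyond the largest one.\<close>
      ultimately have "q + p \<in> C"
        using p by (simp add: C_def)
      then show False
        using q_max[of "q + p"] p by simp
    qed
  qed
  ultimately have mem: "\<sigma> \<in> indec_132 (card (inversions \<sigma>))" "\<tau> \<in> indec_213 (card (inversions \<tau>))"
    using av3 av4 by (simp_all add: indec_132_def indec_213_def)
  have len: "length \<sigma> + (length \<mu> + length \<tau>) = length \<pi>"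
    using arg_cong[OF \<pi>, of length] by simp
  then have "length \<mu> = length \<pi> - length \<sigma> - length \<tau>"
    by linarith
  then have "\<mu> = [1..<Suc (length \<pi> - length \<sigma> - length \<tau>)]"
    using inversions_empty_iff[OF \<mu>(2) av3(2)] by metis
  then have glue: "\<pi> = glue (length \<pi>) \<sigma> \<tau>"
    unfolding glue_def using \<pi> by metis
  have "card (inversions \<pi>) = card (inversions \<sigma>) + (card (inversions \<mu>) + card (inversions \<tau>))"
    unfolding card_inversions_direct_sum[OF \<mu>(2) \<tau>(2), symmetric]
      card_inversions_direct_sum[OF perm\<sigma> perm\<mu>\<tau>, symmetric] using \<pi> by metis
  then have "card (inversions \<sigma>) + card (inversions \<tau>) = card (inversions \<pi>)"
    using av3(2) by simp
  with mem glue show ?thesis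
    by (rule that) (use len in linarith)
qed

lemma finite_indec: "finite (indec_132 k)" "finite (indec_213 k)"
proof -
  have "finite {\<pi>. set \<pi> \<subseteq> {..k * k + 1} \<and> length \<pi> \<le> k * k + 1}" (is "finite ?F")
    by (rule finite_lists_length_le) simp
  moreover have "\<pi> \<in> ?F" if "indecomposable \<pi>" "card (inversions \<pi>) = k" for \<pi>
  proof -
    have "set \<pi> = {1..length \<pi>}"
      using that(1) by (simp add: indecomposable_def is_perm_iff)
    then show ?thesis
      using indecomposable_length[OF that(1)] that(2) by auto
  qed
  then have "indec_132 k \<subseteq> ?F" "indec_213 k \<subseteq> ?F"
    by (auto simp: indec_132_def indec_213_def)
  ultimately show "finite (indec_132 k)" "finite (indec_213 k)"
    using finite_subset by blast+
qed

text \<open>Each end has at most \<open>k * k + 1\<close> entries, so two of them fit into length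
  \<open>n\<close>. The same threshold exceeds the length of any indecomposable permutation with
  \<open>k\<close> inversions, so every counted permutation has a cut.\<close>

lemma av_1324_2341:
  assumes n: "2 * (k * k + 1) \<le> n"
  shows "av {[1,3,2,4], [2,3,4,1]} n k = (\<Sum>i\<le>k. card (indec_132 i) * card (indec_132 (k - i)))"
proof -
  let ?P = "{\<pi> \<in> permutations_of_set {1..n}.
     card (inversions \<pi>) = k \<and> (\<forall>q \<in> {[1,3,2,4], [2,3,4,1]}. avoids \<pi> q)}"
  let ?S = "SIGMA i : {..k}. indec_132 i \<times> indec_213 (k - i)"
  let ?g = "\<lambda>(i, \<sigma>, \<tau>). glue n \<sigma> \<tau>"
  have P: "\<pi> \<in> ?P \<longleftrightarrow> is_perm \<pi> \<and> length \<pi> = n \<and> card (inversions \<pi>) = k \<and>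
      avoids \<pi> [1,3,2,4] \<and> avoids \<pi> [2,3,4,1]" for \<pi>
    by (auto simp: is_perm_def length_finite_permutations_of_set)
  have "bij_betw ?g ?S ?P"
    unfolding bij_betw_def
  proof (intro conjI inj_onI subset_antisym subsetI)
    fix x y assume x: "x \<in> ?S" and y: "y \<in> ?S" and eq: "?g x = ?g y"
    obtain i \<sigma> \<tau> i' \<sigma>' \<tau>' where xy: "x = (i, \<sigma>, \<tau>)" "y = (i', \<sigma>', \<tau>')"
      by (metis prod_cases3)
    have "\<sigma> = \<sigma>'" "\<tau> = \<tau>'"
      using glue_inject[of \<sigma> \<tau> \<sigma>' \<tau>' n] x y eq
      by (auto simp: xy indec_132_def indec_213_def)
    \<comment> \<open>The index \<open>i\<close> is recovered as the number of inversions of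
      \<open>\<sigma>\<close>.\<close>
    then show "x = y"
      using x y by (auto simp: xy indec_132_def)
  next
    fix \<pi> assume "\<pi> \<in> ?g ` ?S"
    then obtain i \<sigma> \<tau> where i: "i \<le> k" and \<sigma>: "\<sigma> \<in> indec_132 i" and \<tau>: "\<tau> \<in> indec_213 (k - i)"
      and \<pi>: "\<pi> = glue n \<sigma> \<tau>"
      by auto
    have "length \<sigma> \<le> i * i + 1" "length \<tau> \<le> (k - i) * (k - i) + 1"
      using \<sigma> \<tau> indecomposable_length[of \<sigma>] indecomposable_length[of \<tau>]
      unfolding indec_132_def indec_213_def mem_Collect_eq by metis+
    moreover have "i * i \<le> k * k" "(k - i) * (k - i) \<le> k * k"
      using i by (simp_all add: mult_le_mono)
    ultimately have "length \<sigma> \<le> k * k + 1" "length \<tau> \<le> k * k + 1"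
      by (meson add_le_mono1 le_trans)+
    then have "length \<sigma> + length \<tau> \<le> n"
      using n unfolding mult_2 by (meson add_mono le_trans)
    then show "\<pi> \<in> ?P"
      unfolding P \<pi> using glue_props[OF \<sigma> \<tau>] i by simp
  next
    fix \<pi> assume "\<pi> \<in> ?P"
    then have \<pi>: "is_perm \<pi>" "length \<pi> = n" "card (inversions \<pi>) = k"
      "avoids \<pi> [1,3,2,4]" "avoids \<pi> [2,3,4,1]"
      unfolding P by simp_all
    have "\<not> indecomposable \<pi>"
      using indecomposable_length[of \<pi>] \<pi>(2,3) n by auto
    moreover have "\<pi> \<noteq> []"
      using \<pi>(2) n by auto
    ultimately obtain \<sigma> \<tau> i j where st: "\<sigma> \<in> indec_132 i" "\<tau> \<in> indec_213 j"
      "\<pi> = glue (length \<pi>) \<sigma> \<tau>" "i + j = card (inversions \<pi>)"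
      using glue_surj[OF \<pi>(1) _ _ \<pi>(4,5)] by metis
    then have "(i, \<sigma>, \<tau>) \<in> ?S" "\<pi> = ?g (i, \<sigma>, \<tau>)"
      using \<pi>(2,3) by auto
    then show "\<pi> \<in> ?g ` ?S"
      by (rule rev_image_eqI)
  qed
  then have "av {[1,3,2,4], [2,3,4,1]} n k = card ?S"
    unfolding av_def by (rule bij_betw_same_card[symmetric])
  also have "\<dots> = (\<Sum>i\<le>k. card (indec_132 i \<times> indec_213 (k - i)))"
    by (rule card_SigmaI) (simp_all add: finite_indec)
  finally show ?thesis
    by (simp add: card_cartesian_product card_indec_213)
qed

theorem proposition5p11:
  defines "T \<equiv> \<lambda>k. (fps_X :: rat fps) ^ (k * (k + 1) div 2) *
                     (\<Prod>i = 1..k. (fps_X + 1 / (1 - fps_X ^ i)))"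
  shows "(\<forall>k. \<exists>f. bij_betw f
            {\<pi>. indecomposable \<pi> \<and> avoids \<pi> [1,3,2] \<and> avoids \<pi> [2,3,4,1] \<and>
                 card (inversions \<pi>) = k}
            (SPM k))
       \<and> (\<exists>c. is_limit_sequence {[1,3,2,4], [2,3,4,1]} c)
       \<and> summable (\<lambda>k. T (Suc k))
       \<and> limit_gf {[1,3,2,4], [2,3,4,1]} = (1 + (\<Sum>k. T (Suc k)))\<^sup>2"
proof (intro conjI allI)
  fix k
  show "\<exists>f. bij_betw f
            {\<pi>. indecomposable \<pi> \<and> avoids \<pi> [1,3,2] \<and> avoids \<pi> [2,3,4,1] \<and>
                 card (inversions \<pi>) = k}
            (SPM k)"
    using bij_betw_indec_132_sand_piles[of k] unfolding indec_132_def SPM_eq_sand_piles by blast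
next
  let ?B = "{[1,3,2,4], [2,3,4,1]} :: nat list set"
  let ?a = "\<lambda>k. card (sand_piles k)"
  let ?A = "Abs_fps (\<lambda>k. of_nat (?a k)) :: rat fps"
  have card: "card (indec_132 k) = ?a k" for k
    by (rule bij_betw_same_card[OF bij_betw_indec_132_sand_piles])
  \<comment> \<open>The limit coefficients are the convolution of the sand pile counts with
    themselves, so the limit series is the square of \<open>?A\<close>.\<close>
  have lim: "is_limit_sequence ?B (\<lambda>k. \<Sum>i\<le>k. ?a i * ?a (k - i))"
    unfolding is_limit_sequence_def using av_1324_2341 by (metis (no_types, lifting) card sum.cong)
  then show "\<exists>c. is_limit_sequence ?B c"
    by blast
  have sums: "(\<lambda>k. T (Suc k)) sums (?A - 1)"
    unfolding T_def by (rule sand_piles_gf)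
  then show "summable (\<lambda>k. T (Suc k))"
    by (rule sums_summable)
  have "1 + (\<Sum>k. T (Suc k)) = ?A"
    unfolding sums_unique[OF sums, symmetric] by simp
  moreover have "limit_gf ?B = ?A * ?A"
    unfolding limit_gf_def limit_sequence_eq[OF lim]
    by (simp add: fps_eq_iff fps_mult_nth atLeast0AtMost)
  ultimately show "limit_gf ?B = (1 + (\<Sum>k. T (Suc k)))\<^sup>2"
    by (simp add: power2_eq_square)
qed

end
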